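(* There exists a function $f\in\bigcap_{\alpha\in(0,1)}C^{1,\alpha}([0,1]^2)$ which has the weak Sard property, i.e. $f_\#(\mathbf{1}_{S\cap E^*}\mathcal{L}^2)\perp\mathcal{L}^1$, but does not have the relaxed Sard property, i.e. $f_\#(\mathbf{1}_{S}\mathcal{L}^2)$ is not mutually singular with $\mathcal{L}^1$.
   Context: $\mathcal{L}^d$ denotes Lebesgue measure on $\mathbb{R}^d$, $\mathcal{H}^1$ the one-dimensional Hausdorff measure, $\mathbf{1}_A$ the indicator function of $A$, $f_\#\mu$ the pushforward of a measure $\mu$ under $f$, and $\mu\perp\nu$ means mutual singularity. $C^{1,\alpha}([0,1]^2)$ is the space of $C^1$ functions whose gradient is $\alpha$-Hölder continuous. The critical set $S$ of $f$ is the set of all $x\in[0,1]^2$ at which $f$ is either not differentiable or $\nabla f(x)=0$. For $t\in\mathbb{R}$ let $E_t=f^{-1}(t)$, let $E_t^*$ be the union of all connected components of $E_t$ with strictly positive $\mathcal{H}^1$-measure, and $E^*:=\bigcup_{t\in\mathbb{R}}E_t^*$. *)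

theory Defs
  imports "HOL-Analysis.Analysis"
begin

definition unit_square :: "(real^2) set" where
  "unit_square = cbox 0 1"

text \<open>C^{1,alpha}([0,1]^2): f is differentiable (relative to the square) at every point of
  the square with gradient g x, and g is alpha-Hoelder continuous on the square
  (hence continuous, so f is C^1).\<close>
definition C1_alpha :: "real \<Rightarrow> (real^2 \<Rightarrow> real) \<Rightarrow> bool" where
  "C1_alpha \<alpha> f \<longleftrightarrow>
     (\<exists>g :: real^2 \<Rightarrow> real^2.
        (\<forall>x\<in>unit_square. (f has_derivative (\<lambda>h. g x \<bullet> h)) (at x within unit_square)) \<and>
        (\<exists>C. \<forall>x\<in>unit_square. \<forall>y\<in>unit_square. norm (g x - g y) \<le> C * dist x y powr \<alpha>))"

definition critical_set :: "(real^2 \<Rightarrow> real) \<Rightarrow> (real^2) set" where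
  "critical_set f = {x \<in> unit_square.
      \<not> f differentiable (at x within unit_square) \<or>
      (f has_derivative (\<lambda>h. 0)) (at x within unit_square)}"

definition hausdorff1 :: "'a::metric_space set \<Rightarrow> ennreal" where
  "hausdorff1 A = (SUP \<delta>\<in>{0<..}.
      INF C\<in>{C :: nat \<Rightarrow> 'a set. A \<subseteq> \<Union>(range C) \<and> (\<forall>i. bounded (C i) \<and> diameter (C i) \<le> \<delta>)}.
        (\<Sum>i. ennreal (diameter (C i))))"

definition level_set :: "(real^2 \<Rightarrow> real) \<Rightarrow> real \<Rightarrow> (real^2) set" where
  "level_set f t = {x \<in> unit_square. f x = t}"

definition level_star :: "(real^2 \<Rightarrow> real) \<Rightarrow> real \<Rightarrow> (real^2) set" where
  "level_star f t = \<Union>{K. \<exists>x\<in>level_set f t. K = connected_component_set (level_set f t) x \<and> hausdorff1 K > 0}"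

definition E_star :: "(real^2 \<Rightarrow> real) \<Rightarrow> (real^2) set" where
  "E_star f = (\<Union>t. level_star f t)"

definition pushforward :: "(real^2 \<Rightarrow> real) \<Rightarrow> (real^2) set \<Rightarrow> real measure" where
  "pushforward f A = distr (density (lebesgue_on unit_square) (indicator A)) borel f"

definition mutually_singular :: "'a measure \<Rightarrow> 'a measure \<Rightarrow> bool" where
  "mutually_singular \<mu> \<nu> \<longleftrightarrow>
     (\<exists>N. N \<in> sets \<mu> \<and> N \<in> sets \<nu> \<and> emeasure \<mu> N = 0 \<and> emeasure \<nu> (space \<nu> - N) = 0)"

end

theory Submission
  imports Defs
begin

text \<open>
  The function is separable: \<open>f (x, y) = 2 G x + G y\<close>, where \<open>G\<close> has vanishing derivative on a
  Cantor set \<open>C\<close> of measure \<open>1/2\<close>. The stage-\<open>n\<close> intervals of \<open>C\<close> have length about \<open>2\<^sup>-\<^sup>n\<close>, and in both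
  halves of such an interval \<open>G\<close> climbs, across margins of length about \<open>2\<^sup>-\<^sup>n / n\<^sup>2\<close>, to a plateau on
  the child interval, of height \<open>12 / 4\<^sup>n\<close> in one half and \<open>13 / 4\<^sup>n\<close> in the other. The slopes are of
  size \<open>2\<^sup>-\<^sup>n n\<^sup>2\<close> with Lipschitz constant \<open>n\<^sup>4\<close>, so \<open>G'\<close> is \<open>\<alpha>\<close>-Hoelder for every \<open>\<alpha> < 1\<close>.

  On \<open>C \<times> C\<close> the function is, up to a constant, \<open>\<Sum>n. (2 d\<^sub>n x + d\<^sub>n y) / 4\<^sup>n\<close> with binary digits
  \<open>d\<^sub>n\<close>; a value determines the stage-\<open>n\<close> square up to boundedly many choices, so the image of Lebesgue
  measure on \<open>C \<times> C\<close> is absolutely continuous. Outside \<open>C\<close> the zeros of \<open>G'\<close> are countable, so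
  almost every critical point lies in \<open>C \<times> C\<close>. There the plateaus make \<open>f\<close> too high for a connected
  piece of a level set to leave the current square without changing its value, so the level set
  components of these points are singletons, and the critical points in \<open>E\<^sup>*\<close> form a null set.
\<close>

subsection \<open>A smooth step and the folding maps\<close>

text \<open>The integral of the hat \<open>tent\<close>, which has height 2 and area 1 on [0, 1].
  Truncated powers avoid a case split at the knots 0, 1/2, 1: one differentiation rule serves every
  term.\<close>

definition ramp :: "real \<Rightarrow> real" where
  "ramp t = 2 * (max 0 t)\<^sup>2 - 4 * (max 0 (t - 1/2))\<^sup>2 + 2 * (max 0 (t - 1))\<^sup>2"

definition tent :: "real \<Rightarrow> real" where
  "tent t = 4 * max 0 t - 8 * max 0 (t - 1/2) + 4 * max 0 (t - 1)"

lemma DERIV_abs_nonzero: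
  fixes x :: real
  assumes "x \<noteq> 0"
  shows "(abs has_real_derivative sgn x) (at x)"
proof (cases "x > 0")
  case True
  then have "((\<lambda>t. t) has_real_derivative sgn x) (at x)" by (auto intro!: derivative_eq_intros)
  then show ?thesis
    by (rule has_field_derivative_transform_within_open[where S = "{0<..}"]) (use True in auto)
next
  case False
  then have "((\<lambda>t. - t) has_real_derivative sgn x) (at x)"
    using assms by (auto intro!: derivative_eq_intros)
  then show ?thesis
    by (rule has_field_derivative_transform_within_open[where S = "{..<0}"]) (use False assms in auto)
qed

lemma DERIV_max_0_squared: "((\<lambda>t::real. (max 0 t)\<^sup>2) has_real_derivative 2 * max 0 x) (at x)"
proof -
  \<comment> \<open>The corner of max is moved into t * |t|, whose difference quotient at 0 is
    |h|.\<close>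
  have *: "(\<lambda>t::real. (max 0 t)\<^sup>2) = (\<lambda>t. (t\<^sup>2 + t * \<bar>t\<bar>) / 2)"
    by (auto simp: max_def power2_eq_square)
  have abs: "((\<lambda>t::real. t * \<bar>t\<bar>) has_real_derivative 2 * \<bar>x\<bar>) (at x)"
  proof (cases "x = 0")
    case True
    have "((\<lambda>h::real. \<bar>h\<bar>) \<longlongrightarrow> 0) (at 0)" by (simp add: tendsto_rabs_zero)
    moreover have "\<forall>\<^sub>F h in at (0::real). (h * \<bar>h\<bar> - 0) / h = \<bar>h\<bar>"
      by (auto simp: eventually_at intro!: exI[of _ 1])
    ultimately have "((\<lambda>h::real. (h * \<bar>h\<bar> - 0) / h) \<longlongrightarrow> 0) (at 0)"
      using tendsto_cong by fastforce
    then show ?thesis using True by (simp add: DERIV_def)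
  next
    case False
    have "((\<lambda>t. t * \<bar>t\<bar>) has_real_derivative 1 * \<bar>x\<bar> + sgn x * x) (at x)"
      by (rule DERIV_mult[OF DERIV_ident DERIV_abs_nonzero[OF False]])
    then show ?thesis by (simp add: abs_sgn mult.commute)
  qed
  show ?thesis unfolding *
    by (rule derivative_eq_intros abs | simp add: max_def)+
qed

lemma DERIV_ramp: "(ramp has_real_derivative tent x) (at x)"
proof -
  have s: "((\<lambda>t. (max 0 (t - a))\<^sup>2) has_real_derivative 2 * max 0 (x - a)) (at x)" for a
    using DERIV_shift[of "\<lambda>t. (max 0 t)\<^sup>2" "2 * max 0 (x - a)" x "-a"]
      DERIV_max_0_squared[of "x - a"] by simp
  show ?thesis unfolding ramp_def[abs_def] tent_def
    by (rule derivative_eq_intros DERIV_max_0_squared s refl | simp)+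
qed

lemma tent_eq: "tent t = max 0 (min (4 * t) (4 - 4 * t))"
  by (auto simp: tent_def max_def min_def)

lemma tent_lipschitz: "\<bar>tent t - tent u\<bar> \<le> 4 * \<bar>t - u\<bar>"
  by (auto simp: tent_eq max_def min_def abs_if)

lemma tent_bounds: "0 \<le> tent t" "tent t \<le> 2"
  by (auto simp: tent_eq max_def min_def)

lemma tent_eq_0_iff: "tent t = 0 \<longleftrightarrow> t \<le> 0 \<or> 1 \<le> t"
  by (auto simp: tent_eq max_def min_def)

lemma ramp_0: "t \<le> 0 \<Longrightarrow> ramp t = 0"
  by (simp add: ramp_def)

lemma ramp_1: "1 \<le> t \<Longrightarrow> ramp t = 1"
  by (simp add: ramp_def power2_eq_square algebra_simps)

lemma ramp_mono: "t \<le> u \<Longrightarrow> ramp t \<le> ramp u"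
  using DERIV_nonneg_imp_nondecreasing[of t u ramp] DERIV_ramp tent_bounds(1) by blast

lemma ramp_bounds: "0 \<le> ramp t" "ramp t \<le> 1"
  using ramp_mono[of "min 0 t" t] ramp_0[of "min 0 t"] ramp_mono[of t "max 1 t"] ramp_1[of "max 1 t"]
  by auto

text \<open>Half the length of the stage-\<open>n\<close> intervals, and the length removed at both ends of each half
  of such an interval; the values make \<open>2\<^sup>n * (2 * half_width n)\<close> telescope down to \<open>1/2\<close>.\<close>

definition half_width :: "nat \<Rightarrow> real" where
  "half_width n = (real n + 2) / (4 * (real n + 1) * 2 ^ n)"

definition margin :: "nat \<Rightarrow> real" where
  "margin n = 1 / (8 * (real n + 1) * (real n + 2) * 2 ^ n)"

lemma half_width_0: "half_width 0 = 1/2" by (simp add: half_width_def)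

lemma half_width_pos: "0 < half_width n" by (simp add: half_width_def)

lemma margin_pos: "0 < margin n" by (simp add: margin_def)

lemma half_width_Suc: "half_width (Suc n) = half_width n / 2 - margin n"
proof -
  have "2 ^ n > (0::real)" "real n + 1 > 0" "real n + 2 > 0" "real n + 3 > 0" by auto
  then show ?thesis unfolding half_width_def margin_def
    by (simp add: divide_simps) (simp add: algebra_simps)
qed

lemma half_width_le: "half_width n \<le> 1 / (2 * 2 ^ n)"
  unfolding half_width_def by (simp add: divide_simps)

lemma half_width_ge: "1 / (4 * 2 ^ n) \<le> half_width n"
  unfolding half_width_def by (simp add: divide_simps)

text \<open>Signed distance to the centre of the stage-\<open>n\<close> interval, up to orientation: taking absolute
  values reflects one half of each interval onto the other, which makes all intervals of a stage
  look alike. The point lies in stage \<open>n\<close> iff \<open>\<bar>folded n x\<bar> \<le> half_width n\<close>.\<close>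

fun folded :: "nat \<Rightarrow> real \<Rightarrow> real" where
  "folded 0 x = x - 1/2"
| "folded (Suc n) x = \<bar>folded n x\<bar> - half_width n / 2"

text \<open>Chain-rule factor of \<open>folded n\<close>: its slope, 1 or -1, away from the folding
  points. At a folding point sgn 0 = 0 makes the factor vanish.\<close>

definition orient :: "nat \<Rightarrow> real \<Rightarrow> real" where
  "orient n x = (\<Prod>m<n. sgn (folded m x))"

text \<open>A child interval keeps distance \<open>margin n\<close> from the ends and from the
  centre of its parent.\<close>

lemma folded_Suc_bounded_imp:
  assumes "\<bar>folded (Suc n) x\<bar> \<le> half_width (Suc n)"
  shows "\<bar>folded n x\<bar> < half_width n" "folded n x \<noteq> 0"
  using assms half_width_Suc[of n] margin_pos[of n] half_width_pos[of n] by auto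

lemma folded_bounded_antimono:
  "m \<le> n \<Longrightarrow> \<bar>folded n x\<bar> \<le> half_width n \<Longrightarrow> \<bar>folded m x\<bar> \<le> half_width m"
proof (induction rule: inc_induct)
  case (step k)
  then show ?case using folded_Suc_bounded_imp(1)[of k x] by simp
qed

lemma continuous_on_folded: "continuous_on S (folded n)"
  by (induction n) (auto intro!: continuous_intros)

text \<open>The corner of |s| at 0 does no harm because b is flat at -c: its Caratheodory slope q
  tends to 0 there, and the quotient for |s| - c is q up to sign.\<close>

lemma DERIV_abs_shift:
  fixes b h :: "real \<Rightarrow> real"
  assumes b: "\<And>s. (b has_real_derivative h s) (at s)" and 0: "h (-c) = 0"
  shows "((\<lambda>s. b (\<bar>s\<bar> - c)) has_real_derivative sgn s * h (\<bar>s\<bar> - c)) (at s)"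
proof (cases "s = 0")
  case False
  have "((\<lambda>s. \<bar>s\<bar> - c) has_real_derivative sgn s) (at s)"
    using DERIV_diff[OF DERIV_abs_nonzero[OF False] DERIV_const] by simp
  from DERIV_chain2[OF b this] show ?thesis by (simp add: mult.commute)
next
  case True
  obtain q where q: "\<And>z. b z - b (-c) = q z * (z - - c)" "isCont q (-c)" "q (-c) = 0"
    using b[of "-c"] 0 unfolding DERIV_caratheodory_within by metis
  have "isCont (\<lambda>s. q (\<bar>s\<bar> - c)) 0"
    by (rule continuous_at_compose[unfolded o_def, where g = q])
       (use q in \<open>auto intro!: continuous_intros\<close>)
  then have t: "((\<lambda>s. q (\<bar>s\<bar> - c)) \<longlongrightarrow> 0) (at 0)"
    using q(3) by (simp add: isCont_def)
  have "((\<lambda>s. (b (\<bar>s\<bar> - c) - b (-c)) / s) \<longlongrightarrow> 0) (at 0)"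
  proof (rule Lim_null_comparison[OF _ tendsto_rabs_zero[OF t]])
    show "\<forall>\<^sub>F x in at 0. norm ((b (\<bar>x\<bar> - c) - b (- c)) / x) \<le> \<bar>q (\<bar>x\<bar> - c)\<bar>"
      by (auto simp: q(1) abs_mult abs_divide divide_simps)
  qed
  then show ?thesis using True by (simp add: DERIV_def)
qed

text \<open>For s and t of opposite sign |s - t| = |s| + |t|, and h (-c) = 0 bounds each term
  separately. So B is not enlarged and survives any number of folds.\<close>

lemma lipschitz_abs_shift:
  fixes h :: "real \<Rightarrow> real"
  assumes h: "\<And>s t. \<bar>h s - h t\<bar> \<le> B * \<bar>s - t\<bar>" and 0: "h (-c) = 0"
  shows "\<bar>sgn s * h (\<bar>s\<bar> - c) - sgn t * h (\<bar>t\<bar> - c)\<bar> \<le> B * \<bar>s - t\<bar>"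
proof -
  have e: "\<bar>h (\<bar>s\<bar> - c)\<bar> \<le> B * \<bar>s\<bar>" for s using h[of "\<bar>s\<bar> - c" "-c"] 0 by simp
  consider "s = 0" | "t = 0" | "s > 0" "t > 0" | "s < 0" "t < 0" | "s > 0" "t < 0" | "s < 0" "t > 0"
    by linarith
  then show ?thesis
  proof cases
    case 3
    then show ?thesis using h[of "\<bar>s\<bar> - c" "\<bar>t\<bar> - c"] by simp
  next
    case 4
    then show ?thesis using h[of "\<bar>s\<bar> - c" "\<bar>t\<bar> - c"] by (simp add: abs_minus_commute)
  next
    case 5
    then have "B * \<bar>s - t\<bar> = B * \<bar>s\<bar> + B * \<bar>t\<bar>" by (simp add: algebra_simps)
    then show ?thesis using 5 e[of s] e[of t] by simp
  next
    case 6
    then have "B * \<bar>s - t\<bar> = B * \<bar>s\<bar> + B * \<bar>t\<bar>" by (simp add: algebra_simps)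
    then show ?thesis using 6 e[of s] e[of t] by simp
  qed (use e[of s] e[of t] in \<open>auto simp: abs_mult sgn_if\<close>)
qed

text \<open>Side conditions for undoing one fold: support in the stage \<open>Suc n\<close> interval
  becomes support in the stage n interval, with a zero at the fold.\<close>

lemma abs_shift_outside:
  assumes "\<And>s. half_width (Suc n) \<le> \<bar>s\<bar> \<Longrightarrow> h s = (0::real)"
  shows "h (- (half_width n / 2)) = 0" "half_width n \<le> \<bar>s\<bar> \<Longrightarrow> h (\<bar>s\<bar> - half_width n / 2) = 0"
  using assms half_width_Suc[of n] margin_pos[of n] half_width_pos[of n] by (auto intro!: assms)

text \<open>The last fold is absorbed into b, so the induction, general in b and h, removes one fold
  at a time.\<close>

lemma DERIV_folded:
  assumes "\<And>s. (b has_real_derivative h s) (at s)" "\<And>s. half_width n \<le> \<bar>s\<bar> \<Longrightarrow> h s = 0"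
  shows "((\<lambda>x. b (folded n x)) has_real_derivative orient n x * h (folded n x)) (at x)"
  using assms
proof (induction n arbitrary: b h)
  case 0
  have "((\<lambda>x. b (x + (-1/2))) has_real_derivative h (x - 1/2)) (at x)"
    using 0(1)[of "x - 1/2"] DERIV_shift[of b "h (x - 1/2)" x "-1/2"] by simp
  then show ?case by (simp add: orient_def)
next
  case (Suc n)
  note z = abs_shift_outside[of n h, OF Suc.prems(2)]
  show ?case
    using Suc.IH[of "\<lambda>s. b (\<bar>s\<bar> - half_width n / 2)", OF DERIV_abs_shift[OF Suc.prems(1)]] z
    by (simp add: orient_def mult.assoc)
qed

lemma lipschitz_folded:
  assumes "\<And>s t. \<bar>h s - h t\<bar> \<le> B * \<bar>s - t\<bar>" "\<And>s. half_width n \<le> \<bar>s\<bar> \<Longrightarrow> h s = 0"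
  shows "\<bar>orient n x * h (folded n x) - orient n y * h (folded n y)\<bar> \<le> B * \<bar>x - y\<bar>"
  using assms
proof (induction n arbitrary: h)
  case 0
  then show ?case using 0(1)[of "x - 1/2" "y - 1/2"] by (simp add: orient_def)
next
  case (Suc n)
  note z = abs_shift_outside[of n h, OF Suc.prems(2)]
  show ?case
    using Suc.IH[of "\<lambda>s. sgn s * h (\<bar>s\<bar> - half_width n / 2)", OF lipschitz_abs_shift[OF Suc.prems(1)]] z
    by (simp add: orient_def mult.assoc)
qed

lemma abs_orient_le: "\<bar>orient n x\<bar> \<le> 1"
  unfolding orient_def abs_prod by (rule prod_le_1) (auto simp: sgn_if)

subsection \<open>Plateau functions\<close>

text \<open>A rising ramp at the left end and its mirror image at the right end, normalised so that
  the flat top of height 1 is exactly the child interval.\<close>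

definition plateau :: "nat \<Rightarrow> real \<Rightarrow> real" where
  "plateau n u = ramp ((half_width n / 2 + u) / margin n) + ramp ((half_width n / 2 - u) / margin n) - 1"

definition plateau_deriv :: "nat \<Rightarrow> real \<Rightarrow> real" where
  "plateau_deriv n u = (tent ((half_width n / 2 + u) / margin n) - tent ((half_width n / 2 - u) / margin n)) / margin n"

lemma DERIV_plateau: "(plateau n has_real_derivative plateau_deriv n u) (at u)"
proof -
  have 1: "((\<lambda>u. (half_width n / 2 + u) / margin n) has_real_derivative 1 / margin n) (at u)"
    and 2: "((\<lambda>u. (half_width n / 2 - u) / margin n) has_real_derivative - 1 / margin n) (at u)"
    using margin_pos[of n] by (auto intro!: derivative_eq_intros)
  show ?thesis unfolding plateau_def[abs_def] plateau_deriv_def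
    using DERIV_diff[OF DERIV_add[OF DERIV_chain2[OF DERIV_ramp 1] DERIV_chain2[OF DERIV_ramp 2]]
        DERIV_const[of 1]]
    by (simp add: diff_divide_distrib)
qed

lemma plateau_outside:
  assumes "half_width n / 2 \<le> \<bar>u\<bar>"
  shows "plateau n u = 0" "plateau_deriv n u = 0"
proof -
  note m = margin_pos[of n] half_width_Suc[of n] half_width_pos[of "Suc n"]
  have "(half_width n / 2 + u) / margin n \<le> 0 \<and> 1 \<le> (half_width n / 2 - u) / margin n \<or>
        1 \<le> (half_width n / 2 + u) / margin n \<and> (half_width n / 2 - u) / margin n \<le> 0"
    using assms m by (cases "u > 0") (auto simp: divide_le_0_iff le_divide_eq)
  then show "plateau n u = 0" "plateau_deriv n u = 0"
    unfolding plateau_def plateau_deriv_def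
    by (auto simp: ramp_0 ramp_1 tent_eq_0_iff[THEN iffD2])
qed

lemma plateau_inside:
  assumes "\<bar>u\<bar> \<le> half_width (Suc n)"
  shows "plateau n u = 1" "plateau_deriv n u = 0"
proof -
  have "1 \<le> (half_width n / 2 + u) / margin n" "1 \<le> (half_width n / 2 - u) / margin n"
    using assms margin_pos[of n] half_width_Suc[of n] by (auto simp: le_divide_eq)
  then show "plateau n u = 1" "plateau_deriv n u = 0"
    unfolding plateau_def plateau_deriv_def
    by (auto simp: ramp_1 tent_eq_0_iff[THEN iffD2])
qed

text \<open>In a margin one tent is evaluated strictly inside (0, 1) and the other at or beyond 1,
  so no cancellation occurs.\<close>

lemma plateau_deriv_nonzero:
  assumes "half_width (Suc n) < \<bar>u\<bar>" "\<bar>u\<bar> < half_width n / 2"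
  shows "plateau_deriv n u \<noteq> 0"
proof -
  note m = margin_pos[of n] half_width_Suc[of n] half_width_pos[of "Suc n"]
  have "1 \<le> (half_width n / 2 + u) / margin n \<and> 0 < (half_width n / 2 - u) / margin n \<and> (half_width n / 2 - u) / margin n < 1 \<or>
        1 \<le> (half_width n / 2 - u) / margin n \<and> 0 < (half_width n / 2 + u) / margin n \<and> (half_width n / 2 + u) / margin n < 1"
    using assms m by (cases "u > 0") (auto simp: divide_less_eq le_divide_eq)
  then show ?thesis unfolding plateau_deriv_def
    using tent_eq_0_iff[of "(half_width n / 2 + u) / margin n"] tent_eq_0_iff[of "(half_width n / 2 - u) / margin n"] m
    by auto
qed

lemma plateau_bounds: "0 \<le> plateau n u" "plateau n u \<le> 1"
proof -
  note m = margin_pos[of n] half_width_Suc[of n] half_width_pos[of "Suc n"]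
  have "1 \<le> (half_width n / 2 + u) / margin n \<or> 1 \<le> (half_width n / 2 - u) / margin n"
    using m by (cases "u > 0") (auto simp: le_divide_eq)
  then show "0 \<le> plateau n u" "plateau n u \<le> 1"
    unfolding plateau_def
    using ramp_bounds[of "(half_width n / 2 + u) / margin n"] ramp_bounds[of "(half_width n / 2 - u) / margin n"]
    by (auto simp: ramp_1)
qed

lemma plateau_deriv_bound: "\<bar>plateau_deriv n u\<bar> \<le> 2 / margin n"
proof -
  have "\<bar>tent ((half_width n / 2 + u) / margin n) - tent ((half_width n / 2 - u) / margin n)\<bar> \<le> 2"
    using tent_bounds[of "(half_width n / 2 + u) / margin n"] tent_bounds[of "(half_width n / 2 - u) / margin n"]
    by auto
  then show ?thesis unfolding plateau_deriv_def abs_divide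
    using margin_pos[of n] by (simp add: divide_right_mono)
qed

lemma plateau_deriv_lipschitz:
  "\<bar>plateau_deriv n u - plateau_deriv n v\<bar> \<le> 8 / (margin n)\<^sup>2 * \<bar>u - v\<bar>"
proof -
  let ?d = "margin n" and ?c = "half_width n / 2"
  have d: "?d > 0" by (rule margin_pos)
  have *: "\<bar>(a / ?d) - (b / ?d)\<bar> = \<bar>a - b\<bar> / ?d" for a b
    using d by (simp flip: diff_divide_distrib)
  have 1: "\<bar>tent ((?c + u) / ?d) - tent ((?c + v) / ?d)\<bar> \<le> 4 * (\<bar>u - v\<bar> / ?d)"
    using tent_lipschitz[of "(?c + u) / ?d" "(?c + v) / ?d"] unfolding * by simp
  have 2: "\<bar>tent ((?c - u) / ?d) - tent ((?c - v) / ?d)\<bar> \<le> 4 * (\<bar>u - v\<bar> / ?d)"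
    using tent_lipschitz[of "(?c - u) / ?d" "(?c - v) / ?d"] unfolding *
    by (simp add: abs_minus_commute)
  have "\<bar>plateau_deriv n u - plateau_deriv n v\<bar> =
      \<bar>(tent ((?c + u) / ?d) - tent ((?c + v) / ?d)) - (tent ((?c - u) / ?d) - tent ((?c - v) / ?d))\<bar> / ?d"
    unfolding plateau_deriv_def * by (simp add: algebra_simps)
  also have "\<dots> \<le> (8 * (\<bar>u - v\<bar> / ?d)) / ?d"
    by (rule divide_right_mono) (use 1 2 d in auto)
  finally show ?thesis by (simp add: power2_eq_square)
qed

text \<open>The heights 12 and 13 come from \<open>2 * (4/3) * 13 + 13 < 3 * (4/3) * 12\<close>: a point with one
  coordinate in a stage-\<open>n\<close> margin lies strictly below every dust point with the same earlier digits.\<close>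

definition bump :: "nat \<Rightarrow> real \<Rightarrow> real" where
  "bump n s = (13 * plateau n (s - half_width n / 2) + 12 * plateau n (s + half_width n / 2)) / 4 ^ n"

definition bump_deriv :: "nat \<Rightarrow> real \<Rightarrow> real" where
  "bump_deriv n s = (13 * plateau_deriv n (s - half_width n / 2) + 12 * plateau_deriv n (s + half_width n / 2)) / 4 ^ n"

lemma DERIV_bump: "(bump n has_real_derivative bump_deriv n s) (at s)"
proof -
  have "((\<lambda>s. plateau n (s + a)) has_real_derivative plateau_deriv n (s + a)) (at s)" for a
    using DERIV_plateau[of n "s + a"] by (simp add: DERIV_shift)
  from this[of "half_width n / 2"] this[of "- half_width n / 2"] show ?thesis
    unfolding bump_def[abs_def] bump_deriv_def
    by (auto intro!: derivative_eq_intros)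
qed

lemma bump_outside:
  assumes "half_width n \<le> \<bar>s\<bar>"
  shows "bump n s = 0" "bump_deriv n s = 0"
  using assms half_width_pos[of n] unfolding bump_def bump_deriv_def
  by (auto simp: plateau_outside abs_if split: if_splits)

text \<open>On each half only one of the two plateaus is alive. The form with |s| matches
  \<open>folded (Suc n)\<close> and treats both halves alike.\<close>

lemma bump_pos: "s \<ge> 0 \<Longrightarrow> bump n s = 13 * plateau n (\<bar>s\<bar> - half_width n / 2) / 4 ^ n"
  "s \<ge> 0 \<Longrightarrow> bump_deriv n s = 13 * plateau_deriv n (\<bar>s\<bar> - half_width n / 2) / 4 ^ n"
  using half_width_pos[of n] unfolding bump_def bump_deriv_def by (auto simp: plateau_outside)

lemma plateau_minus: "plateau n (- u) = plateau n u" "plateau_deriv n (- u) = - plateau_deriv n u"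
  by (simp_all add: plateau_def plateau_deriv_def diff_divide_distrib)

lemma bump_neg: "s \<le> 0 \<Longrightarrow> bump n s = 12 * plateau n (\<bar>s\<bar> - half_width n / 2) / 4 ^ n"
  "s \<le> 0 \<Longrightarrow> bump_deriv n s = - 12 * plateau_deriv n (\<bar>s\<bar> - half_width n / 2) / 4 ^ n"
  using half_width_pos[of n] plateau_minus[of n "s + half_width n / 2"] unfolding bump_def bump_deriv_def
  by (auto simp: plateau_outside)

lemma bump_bounds: "0 \<le> bump n s" "bump n s \<le> 13 / 4 ^ n"
  using bump_pos(1)[of s n] bump_neg(1)[of s n] plateau_bounds[of n "\<bar>s\<bar> - half_width n / 2"]
  by (cases "s \<ge> 0"; auto intro!: divide_right_mono)+

lemma bump_inside:
  assumes "\<bar>\<bar>s\<bar> - half_width n / 2\<bar> \<le> half_width (Suc n)"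
  shows "bump n s = (12 + of_bool (s > 0)) / 4 ^ n" "bump_deriv n s = 0"
proof -
  have "s \<noteq> 0" using assms half_width_Suc[of n] margin_pos[of n] half_width_pos[of n] by auto
  then show "bump n s = (12 + of_bool (s > 0)) / 4 ^ n" "bump_deriv n s = 0"
    using bump_pos[of s n] bump_neg[of s n] plateau_inside[OF assms]
    by (cases "s > 0"; simp)+
qed

lemma bump_deriv_nonzero:
  assumes "half_width (Suc n) < \<bar>\<bar>s\<bar> - half_width n / 2\<bar>" "s \<noteq> 0" "\<bar>s\<bar> < half_width n"
  shows "bump_deriv n s \<noteq> 0"
proof -
  have "0 < \<bar>s\<bar>" using assms(2) by simp
  with assms(3) have "\<bar>\<bar>s\<bar> - half_width n / 2\<bar> < half_width n / 2" unfolding abs_diff_less_iff by linarith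
  then have "plateau_deriv n (\<bar>s\<bar> - half_width n / 2) \<noteq> 0"
    by (rule plateau_deriv_nonzero[OF assms(1)])
  then show ?thesis using bump_pos(2)[of s n] bump_neg(2)[of s n] by (cases "s \<ge> 0") auto
qed

lemma bump_deriv_bound: "\<bar>bump_deriv n s\<bar> \<le> 50 / (margin n * 4 ^ n)"
proof -
  have "\<bar>13 * plateau_deriv n (s - half_width n / 2) + 12 * plateau_deriv n (s + half_width n / 2)\<bar> \<le> 50 / margin n"
    using plateau_deriv_bound[of n "s - half_width n / 2"] plateau_deriv_bound[of n "s + half_width n / 2"] by linarith
  then show ?thesis unfolding bump_deriv_def abs_divide
    by (simp add: divide_right_mono flip: divide_divide_eq_left)
qed

lemma bump_deriv_lipschitz:
  "\<bar>bump_deriv n s - bump_deriv n t\<bar> \<le> 200 / ((margin n)\<^sup>2 * 4 ^ n) * \<bar>s - t\<bar>"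
proof -
  let ?c = "half_width n / 2" and ?B = "8 / (margin n)\<^sup>2 * \<bar>s - t\<bar>"
  have "\<bar>bump_deriv n s - bump_deriv n t\<bar> =
      \<bar>13 * (plateau_deriv n (s - ?c) - plateau_deriv n (t - ?c)) +
       12 * (plateau_deriv n (s + ?c) - plateau_deriv n (t + ?c))\<bar> / 4 ^ n"
    unfolding bump_deriv_def by (simp add: algebra_simps flip: diff_divide_distrib)
  also have "\<dots> \<le> (25 * ?B) / 4 ^ n"
    by (rule divide_right_mono)
       (use plateau_deriv_lipschitz[of n "s - ?c" "t - ?c"]
         plateau_deriv_lipschitz[of n "s + ?c" "t + ?c"] in auto)
  finally show ?thesis by simp
qed

subsection \<open>The one-dimensional ladder\<close>

lemma summable_power4_geometric:
  fixes q :: real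
  assumes "0 < q" "q < 1"
  shows "summable (\<lambda>n. (real n + 2) ^ 4 * q ^ n)"
proof -
  \<comment> \<open>Of the five factors p^n in q^n, four absorb the quartic polynomial and one is
    left for geometric convergence.\<close>
  define p where "p = root 5 q"
  have p: "0 < p" "p < 1" "p ^ 5 = q" using assms by (auto simp: p_def)
  have "(\<lambda>n. real n * p ^ n + 2 * p ^ n) \<longlonglongrightarrow> 0 + 2 * 0"
    by (intro tendsto_intros powser_times_n_limit_0 LIMSEQ_realpow_zero) (use p in auto)
  then have "Bseq (\<lambda>n. real n * p ^ n + 2 * p ^ n)"
    by (metis convergentI convergent_imp_Bseq)
  then obtain B where B: "\<And>n. \<bar>real n * p ^ n + 2 * p ^ n\<bar> \<le> B" by (auto simp: Bseq_def)
  show ?thesis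
  proof (rule summable_comparison_test')
    show "summable (\<lambda>n. B ^ 4 * p ^ n)" using p by (intro summable_mult summable_geometric) auto
    fix n
    have "(real n + 2) ^ 4 * q ^ n = (real n * p ^ n + 2 * p ^ n) ^ 4 * p ^ n"
      unfolding p(3)[symmetric]
      by (simp add: distrib_right[symmetric] power_mult_distrib power_mult[symmetric] power_add[symmetric])
    also have "\<dots> \<le> B ^ 4 * p ^ n"
      using B[of n] p by (intro mult_right_mono power_mono) auto
    finally show "norm ((real n + 2) ^ 4 * q ^ n) \<le> B ^ 4 * p ^ n"
      using assms by simp
  qed
qed

definition ladder :: "real \<Rightarrow> real" where
  "ladder x = (\<Sum>n. bump n (folded n x))"

definition ladder_deriv :: "real \<Rightarrow> real" where
  "ladder_deriv x = (\<Sum>n. orient n x * bump_deriv n (folded n x))"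

text \<open>One polynomial serves both the sup bound and the Lipschitz bound of the derivative
  terms; 12800 = 200 * 64 comes from \<open>bump_deriv_lipschitz\<close> and the 8 in
  \<open>margin\<close>.\<close>

definition weight :: "nat \<Rightarrow> real" where
  "weight n = 12800 * (real n + 2) ^ 4"

lemma summable_weight: "0 < q \<Longrightarrow> q < 1 \<Longrightarrow> summable (\<lambda>n. weight n * q ^ n)"
  using summable_mult[OF summable_power4_geometric, of q 12800] by (simp add: weight_def mult.assoc)

text \<open>The factor 2 is there so that the difference of two such terms is still at most
  \<open>weight n\<close> / 2^n.\<close>

lemma orient_bump_deriv_bound: "2 * \<bar>orient n x * bump_deriv n (folded n x)\<bar> \<le> weight n * (1/2) ^ n"
proof -
  have "\<bar>orient n x * bump_deriv n (folded n x)\<bar> \<le> 1 * (50 / (margin n * 4 ^ n))"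
    unfolding abs_mult using abs_orient_le[of n x] bump_deriv_bound[of n "folded n x"]
    by (intro mult_mono) auto
  also have "\<dots> = 400 * ((real n + 1) * (real n + 2)) * (1/2) ^ n"
  proof -
    have "(4::real) ^ n = 2 ^ n * 2 ^ n" by (simp flip: power_mult_distrib)
    then show ?thesis unfolding margin_def by (simp add: power_divide)
  qed
  also have "\<dots> \<le> 400 * ((real n + 2) ^ 4) * (1/2) ^ n"
  proof (intro mult_right_mono mult_left_mono)
    have "(real n + 1) * (real n + 2) \<le> (real n + 2)\<^sup>2 * 1" by (simp add: power2_eq_square)
    also have "\<dots> \<le> (real n + 2)\<^sup>2 * (real n + 2)\<^sup>2" by (intro mult_left_mono one_le_power) auto
    finally show "(real n + 1) * (real n + 2) \<le> (real n + 2) ^ 4" by (simp flip: power_add)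
  qed auto
  finally have "2 * \<bar>orient n x * bump_deriv n (folded n x)\<bar> \<le> 800 * ((real n + 2) ^ 4 * (1/2) ^ n)"
    by linarith
  also have "\<dots> \<le> 12800 * ((real n + 2) ^ 4 * (1/2) ^ n)" by (intro mult_right_mono) auto
  finally show ?thesis unfolding weight_def by (simp only: mult.assoc)
qed

lemma orient_bump_deriv_lipschitz:
  "\<bar>orient n x * bump_deriv n (folded n x) - orient n y * bump_deriv n (folded n y)\<bar> \<le> weight n * \<bar>x - y\<bar>"
proof -
  have "200 / ((margin n)\<^sup>2 * 4 ^ n) = 12800 * ((real n + 1)\<^sup>2 * (real n + 2)\<^sup>2)"
  proof -
    have "(4::real) ^ n = 2 ^ n * 2 ^ n" by (simp flip: power_mult_distrib)
    then show ?thesis unfolding margin_def by (simp add: power_divide power2_eq_square) (simp add: algebra_simps)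
  qed
  also have "\<dots> \<le> 12800 * ((real n + 2)\<^sup>2 * (real n + 2)\<^sup>2)"
    by (intro mult_left_mono mult_right_mono power_mono) auto
  also have "\<dots> = weight n" by (simp add: weight_def flip: power_add)
  finally have "200 / ((margin n)\<^sup>2 * 4 ^ n) * \<bar>x - y\<bar> \<le> weight n * \<bar>x - y\<bar>"
    by (intro mult_right_mono) auto
  moreover have "\<bar>orient n x * bump_deriv n (folded n x) - orient n y * bump_deriv n (folded n y)\<bar>
      \<le> 200 / ((margin n)\<^sup>2 * 4 ^ n) * \<bar>x - y\<bar>"
    by (rule lipschitz_folded[OF bump_deriv_lipschitz bump_outside(2)])
  ultimately show ?thesis by linarith
qed

lemma weight_nonneg: "0 \<le> weight n" by (simp add: weight_def)

lemma norm_ladder_deriv_term_le: "norm (orient n x * bump_deriv n (folded n x)) \<le> weight n * (1/2) ^ n"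
  using orient_bump_deriv_bound[of n x] by simp

lemma summable_ladder_deriv: "summable (\<lambda>n. orient n x * bump_deriv n (folded n x))"
  by (rule summable_comparison_test'[OF summable_weight norm_ladder_deriv_term_le]) auto

lemma geometric_quarter: "summable (\<lambda>n. c / 4 ^ n :: real)" "(\<Sum>n. c / 4 ^ n :: real) = 4 / 3 * c"
proof -
  have "(\<lambda>n. c * (1/4::real) ^ n) sums (c * (1 / (1 - 1/4)))"
    by (intro sums_mult geometric_sums) auto
  then have "(\<lambda>n. c / 4 ^ n :: real) sums (4 / 3 * c)" by (simp add: power_divide mult.commute)
  then show "summable (\<lambda>n. c / 4 ^ n :: real)" "(\<Sum>n. c / 4 ^ n :: real) = 4 / 3 * c"
    by (auto simp: sums_iff)
qed

lemma summable_ladder: "summable (\<lambda>n. bump n (folded n x))"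
  by (rule summable_comparison_test'[OF geometric_quarter(1)[of 13]]) (use bump_bounds in auto)

lemma DERIV_ladder: "(ladder has_real_derivative ladder_deriv x) (at x)"
proof -
  have u: "uniformly_convergent_on UNIV (\<lambda>n x. \<Sum>i<n. orient i x * bump_deriv i (folded i x))"
    by (rule Weierstrass_m_test'[OF norm_ladder_deriv_term_le summable_weight]) auto
  have d: "((\<lambda>x. bump n (folded n x)) has_field_derivative orient n x * bump_deriv n (folded n x))
      (at x within UNIV)" for n x
    using DERIV_folded[OF DERIV_bump bump_outside(2)] by simp
  show ?thesis unfolding ladder_def[abs_def] ladder_deriv_def
    by (rule has_field_derivative_series'(2)[OF convex_UNIV d u UNIV_I summable_ladder]) simp
qed

text \<open>Interpolation between the sup bound a and the Lipschitz bound b of a term, by splitting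
  the exponent 1 as (1 - \<alpha>) + \<alpha>.\<close>

lemma min_le_powr_mult:
  fixes a b :: real
  assumes "0 < a" "0 < b" "0 < \<alpha>" "\<alpha> < 1"
  shows "min a b \<le> a powr (1 - \<alpha>) * b powr \<alpha>"
proof -
  have "min a b = min a b powr (1 - \<alpha>) * min a b powr \<alpha>"
    using assms by (simp add: min_def flip: powr_add)
  also have "\<dots> \<le> a powr (1 - \<alpha>) * b powr \<alpha>"
    using assms by (intro mult_mono powr_mono2) auto
  finally show ?thesis .
qed

lemma ladder_deriv_holder:
  assumes "0 < \<alpha>" "\<alpha> < 1"
  obtains C where "0 \<le> C" "\<And>x y. \<bar>ladder_deriv x - ladder_deriv y\<bar> \<le> C * \<bar>x - y\<bar> powr \<alpha>"
proof
  \<comment> \<open>Interpolating the term bound \<open>weight n\<close> * min (2^-n) |x - y| leaves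
    the factor q^n, and q < 1 beats the polynomial \<open>weight\<close>.\<close>
  define q where "q = (1/2::real) powr (1 - \<alpha>)"
  have q: "0 < q" "q < 1"
    using assms powr_less_mono2[of "1 - \<alpha>" "1/2" 1] by (auto simp: q_def)
  have qn: "((1/2) ^ n) powr (1 - \<alpha>) = q ^ n" for n :: nat
  proof -
    have "((1/2) ^ n) powr (1 - \<alpha>) = ((1/2::real) powr real n) powr (1 - \<alpha>)"
      by (subst powr_realpow) auto
    also have "\<dots> = q powr real n" unfolding q_def powr_powr by (simp only: mult.commute)
    finally show ?thesis using q by (simp add: powr_realpow)
  qed
  let ?C = "\<Sum>n. weight n * q ^ n"
  show "0 \<le> ?C" using q weight_nonneg by (intro suminf_nonneg summable_weight) auto
  show "\<bar>ladder_deriv x - ladder_deriv y\<bar> \<le> ?C * \<bar>x - y\<bar> powr \<alpha>" for x y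
  proof (cases "x = y")
    case False
    let ?t = "\<lambda>x n. orient n x * bump_deriv n (folded n x)"
    have le: "norm (?t x n - ?t y n) \<le> weight n * q ^ n * \<bar>x - y\<bar> powr \<alpha>" for n
    proof -
      have "norm (?t x n - ?t y n) \<le> weight n * min ((1/2) ^ n) \<bar>x - y\<bar>"
        using orient_bump_deriv_lipschitz[of n x y] orient_bump_deriv_bound[of n x]
          orient_bump_deriv_bound[of n y] by (auto simp: min_def)
      also have "\<dots> \<le> weight n * (((1/2) ^ n) powr (1 - \<alpha>) * \<bar>x - y\<bar> powr \<alpha>)"
        using False assms weight_nonneg by (intro mult_left_mono min_le_powr_mult) auto
      finally show ?thesis unfolding qn by (simp add: mult.assoc)
    qed
    have "\<bar>ladder_deriv x - ladder_deriv y\<bar> = norm (\<Sum>n. ?t x n - ?t y n)"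
      unfolding ladder_deriv_def by (simp add: suminf_diff summable_ladder_deriv)
    also have "\<dots> \<le> (\<Sum>n. weight n * q ^ n * \<bar>x - y\<bar> powr \<alpha>)"
      by (rule norm_suminf_le[OF le]) (intro summable_mult2 summable_weight q)
    also have "\<dots> = ?C * \<bar>x - y\<bar> powr \<alpha>"
      by (intro suminf_mult2[symmetric] summable_weight q)
    finally show ?thesis .
  qed simp
qed

lemma continuous_ladder_deriv: "continuous_on UNIV ladder_deriv"
proof -
  obtain C where C: "0 \<le> C" "\<And>x y. \<bar>ladder_deriv x - ladder_deriv y\<bar> \<le> C * \<bar>x - y\<bar> powr (1/2)"
    using ladder_deriv_holder[of "1/2"] by auto
  have "isCont ladder_deriv x" for x
  proof -
    have "((\<lambda>y. C * \<bar>y - x\<bar> powr (1/2)) \<longlongrightarrow> C * 0 powr (1/2)) (at x)"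
      by (intro tendsto_mult tendsto_const tendsto_powr2 tendsto_rabs_zero LIM_zero tendsto_ident_at) auto
    then have lim: "((\<lambda>y. C * \<bar>y - x\<bar> powr (1/2)) \<longlongrightarrow> 0) (at x)" by simp
    have "((\<lambda>y. ladder_deriv y - ladder_deriv x) \<longlongrightarrow> 0) (at x)"
      by (rule Lim_null_comparison[OF always_eventually lim]) (use C(2) in simp)
    then show ?thesis by (simp add: isCont_def LIM_zero_iff)
  qed
  then show ?thesis by (simp add: continuous_at_imp_continuous_on)
qed

lemma continuous_ladder: "continuous_on S ladder"
  by (meson DERIV_ladder DERIV_isCont continuous_at_imp_continuous_on)

section \<open>The fat Cantor set and the zeros of the derivative\<close>

definition fat_cantor :: "real set" where
  "fat_cantor = {x. \<forall>n. \<bar>folded n x\<bar> \<le> half_width n}"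

lemma folded_eventually_outside:
  assumes "half_width n < \<bar>folded n x\<bar>" "n \<le> m"
  shows "half_width m < \<bar>folded m x\<bar>"
  using assms folded_bounded_antimono[of n m x] by linarith

lemma folded_inside:
  assumes "\<bar>folded (Suc n) x\<bar> \<le> half_width (Suc n)"
  shows "bump n (folded n x) = (12 + of_bool (folded n x > 0)) / 4 ^ n"
    "bump_deriv n (folded n x) = 0"
  using bump_inside[of "folded n x" n] assms by auto

lemma ladder_deriv_fat_cantor: "x \<in> fat_cantor \<Longrightarrow> ladder_deriv x = 0"
  unfolding ladder_deriv_def fat_cantor_def by (simp add: folded_inside del: folded.simps)

text \<open>Let n + 1 be the first stage that misses x. Earlier terms vanish because x is on their
  plateaus, later ones because x is off their supports. The single remaining term is nonzero unless
  some fold sits at its centre or at an end.\<close>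

lemma ladder_deriv_zero_outside:
  assumes "x \<in> {0..1}" "x \<notin> fat_cantor" "ladder_deriv x = 0"
  shows "\<exists>n. folded n x \<in> {0, half_width n, - half_width n}"
proof -
  obtain k where k: "half_width k < \<bar>folded k x\<bar>" "\<And>m. m < k \<Longrightarrow> \<bar>folded m x\<bar> \<le> half_width m"
    using assms(2) exists_least_iff[of "\<lambda>k. half_width k < \<bar>folded k x\<bar>"]
    by (auto simp: fat_cantor_def not_le not_less)
  have "k \<noteq> 0"
  proof
    assume "k = 0"
    with k(1) assms(1) show False by (simp add: half_width_0 abs_if split: if_splits)
  qed
  then obtain n where n: "k = Suc n" by (cases k) auto
  have z: "orient m x * bump_deriv m (folded m x) = 0" if "m \<noteq> n" for m
  proof (cases "m < n")
    case True
    then show ?thesis using k(2)[of "Suc m"] n by (simp add: folded_inside del: folded.simps)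
  next
    case False
    then have "half_width m \<le> \<bar>folded m x\<bar>"
      using folded_eventually_outside[OF k(1), of m] n that by simp
    then show ?thesis by (simp add: bump_outside)
  qed
  have "ladder_deriv x = (\<Sum>m\<in>{n}. orient m x * bump_deriv m (folded m x))"
    unfolding ladder_deriv_def by (rule suminf_finite) (use z in auto)
  then have "orient n x = 0 \<or> bump_deriv n (folded n x) = 0" using assms(3) by simp
  then show ?thesis
  proof
    assume "orient n x = 0"
    then show ?thesis unfolding orient_def by (auto simp: sgn_zero_iff)
  next
    assume "bump_deriv n (folded n x) = 0"
    then have "\<not> (folded n x \<noteq> 0 \<and> \<bar>folded n x\<bar> < half_width n)"
      using bump_deriv_nonzero[of n "folded n x"] k(1) n by auto
    then show ?thesis using k(2)[of n] n by (intro exI[of _ n]) auto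
  qed
qed

text \<open>Each fold is at most two-to-one.\<close>

lemma countable_folded_vimage:
  assumes "countable A"
  shows "countable {x. folded n x \<in> A}"
  using assms
proof (induction n arbitrary: A)
  case 0
  have "{x. folded 0 x \<in> A} = (\<lambda>a. a + 1/2) ` A" by (force simp: image_iff)
  then show ?case using 0 by simp
next
  case (Suc n)
  let ?B = "(\<lambda>a. a + half_width n / 2) ` A \<union> (\<lambda>a. - a - half_width n / 2) ` A"
  have "{x. folded (Suc n) x \<in> A} \<subseteq> {x. folded n x \<in> ?B}"
  proof safe
    fix x assume x: "folded (Suc n) x \<in> A"
       "folded n x \<notin> (\<lambda>a. - a - half_width n / 2) ` A"
    then have "folded n x \<ge> 0"
      by (force simp: image_iff)
    with x(1) show "folded n x \<in> (\<lambda>a. a + half_width n / 2) ` A"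
      by (intro image_eqI[where x = "folded n x - half_width n / 2"]) auto
  qed
  then show ?case using Suc.IH[of ?B] Suc.prems by (meson countable_Un countable_image countable_subset)
qed

lemma countable_ladder_deriv_zero: "countable {x \<in> {0..1}. ladder_deriv x = 0 \<and> x \<notin> fat_cantor}"
proof (rule countable_subset)
  show "{x \<in> {0..1}. ladder_deriv x = 0 \<and> x \<notin> fat_cantor} \<subseteq>
      (\<Union>n. {x. folded n x \<in> {0, half_width n, - half_width n}})"
    using ladder_deriv_zero_outside by blast
  show "countable (\<Union>n. {x. folded n x \<in> {0, half_width n, - half_width n}})"
    by (intro countable_UN countable_folded_vimage) auto
qed

subsection \<open>Level sets\<close>

lemma fat_cantorD: "x \<in> fat_cantor \<Longrightarrow> \<bar>folded n x\<bar> \<le> half_width n"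
  by (simp add: fat_cantor_def)

definition ladder_tail :: "nat \<Rightarrow> real \<Rightarrow> real" where
  "ladder_tail n x = (\<Sum>m. bump (m + n) (folded (m + n) x))"

lemma ladder_split: "ladder x = ladder_tail n x + (\<Sum>m<n. bump m (folded m x))"
  unfolding ladder_def ladder_tail_def by (rule suminf_split_initial_segment[OF summable_ladder])

lemma summable_ladder_tail: "summable (\<lambda>m. bump (m + n) (folded (m + n) x))"
  by (rule summable_ignore_initial_segment[OF summable_ladder])

lemma geometric_tail: "(\<Sum>m. c / 4 ^ (m + n)) = 4 / 3 * (c / 4 ^ n)" "summable (\<lambda>m. c / 4 ^ (m + n) :: real)"
proof -
  have *: "(\<lambda>m. c / 4 ^ (m + n)) = (\<lambda>m. (c / 4 ^ n) / 4 ^ m)" by (simp add: power_add mult.commute)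
  show "(\<Sum>m. c / 4 ^ (m + n)) = 4 / 3 * (c / 4 ^ n)" "summable (\<lambda>m. c / 4 ^ (m + n))"
    unfolding * by (rule geometric_quarter)+
qed

text \<open>52/3 = 13 * 4/3, the greater height summed geometrically.\<close>

lemma ladder_tail_le: "ladder_tail n x \<le> 52 / 3 / 4 ^ n"
proof -
  have "ladder_tail n x \<le> (\<Sum>m. 13 / 4 ^ (m + n))"
    unfolding ladder_tail_def
    by (intro suminf_le bump_bounds summable_ladder_tail geometric_tail)
  then show ?thesis unfolding geometric_tail by simp
qed

text \<open>Outside stage n + 1 only the bump of stage n can contribute.\<close>

lemma ladder_tail_gap:
  assumes "half_width (Suc n) < \<bar>folded (Suc n) x\<bar>"
  shows "ladder_tail n x \<le> 13 / 4 ^ n"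
proof -
  have "ladder_tail n x = (\<Sum>m\<in>{0}. bump (m + n) (folded (m + n) x))"
    unfolding ladder_tail_def
  proof (rule suminf_finite)
    fix m :: nat assume "m \<notin> {0}"
    then have "half_width (m + n) < \<bar>folded (m + n) x\<bar>"
      using folded_eventually_outside[OF assms, of "m + n"] by simp
    then show "bump (m + n) (folded (m + n) x) = 0" by (simp add: bump_outside)
  qed simp
  then show ?thesis using bump_bounds[of n "folded n x"] by simp
qed

text \<open>16 = 12 * 4/3: on the Cantor set every bump attains at least the smaller height.\<close>

lemma ladder_tail_ge:
  assumes "x \<in> fat_cantor"
  shows "16 / 4 ^ n \<le> ladder_tail n x"
proof -
  have "(\<Sum>m. 12 / 4 ^ (m + n)) \<le> ladder_tail n x"
    unfolding ladder_tail_def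
  proof (intro suminf_le summable_ladder_tail geometric_tail)
    fix m
    have "\<bar>folded (Suc (m + n)) x\<bar> \<le> half_width (Suc (m + n))" by (rule fat_cantorD[OF assms])
    from folded_inside(1)[OF this] show "12 / 4 ^ (m + n) \<le> bump (m + n) (folded (m + n) x)"
      by (simp add: divide_right_mono)
  qed
  then show ?thesis unfolding geometric_tail by simp
qed

text \<open>While the two points stay on the same side of 0, each fold is a reflection or the
  identity, up to a shift, on both.\<close>

lemma folded_isometry:
  assumes "\<And>m. m < n \<Longrightarrow> sgn (folded m x) = sgn (folded m y)"
  shows "\<bar>folded n x - folded n y\<bar> = \<bar>x - y\<bar>"
  using assms
proof (induction n)
  case (Suc n)
  have "sgn (folded n x) = sgn (folded n y)" using Suc.prems by simp
  then have "\<bar>\<bar>folded n x\<bar> - \<bar>folded n y\<bar>\<bar> = \<bar>folded n x - folded n y\<bar>"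
    by (auto simp: sgn_if abs_if split: if_splits)
  then show ?case using Suc by simp
qed simp

text \<open>Both points lie in the same interval at every stage, and the interval lengths tend to
  0.\<close>

lemma fat_cantor_eqI:
  assumes "x \<in> fat_cantor" "y \<in> fat_cantor" "\<And>m. sgn (folded m x) = sgn (folded m y)"
  shows "x = y"
proof (rule ccontr)
  assume "x \<noteq> y"
  then obtain n where n: "(1/2) ^ n < \<bar>x - y\<bar>"
    using real_arch_pow_inv[of "\<bar>x - y\<bar>" "1/2"] by auto
  have "\<bar>x - y\<bar> = \<bar>folded n x - folded n y\<bar>" using folded_isometry assms(3) by metis
  also have "\<dots> \<le> half_width n + half_width n" using fat_cantorD[OF assms(1), of n] fat_cantorD[OF assms(2), of n] by linarith
  also have "\<dots> \<le> (1/2) ^ n" using half_width_le[of n] by (simp add: power_divide)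
  finally show False using n by simp
qed

text \<open>The factor 2 merges the binary digits d and e of the two coordinates into one base-4
  digit 2 d + e, which fits the scale 4^-n of the bumps.\<close>

definition staircase :: "real ^ 2 \<Rightarrow> real" where
  "staircase z = 2 * ladder (z $ 1) + ladder (z $ 2)"

definition cantor_dust :: "(real ^ 2) set" where
  "cantor_dust = {z. z $ 1 \<in> fat_cantor \<and> z $ 2 \<in> fat_cantor}"

lemma connected_sgn_eq:
  fixes h :: "'a::topological_space \<Rightarrow> real"
  assumes "connected X" "continuous_on X h" "\<And>z. z \<in> X \<Longrightarrow> h z \<noteq> 0" "z \<in> X" "w \<in> X"
  shows "sgn (h z) = sgn (h w)"
proof (rule ccontr)
  assume ne: "sgn (h z) \<noteq> sgn (h w)"
  have "is_interval (h ` X)"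
    using connected_continuous_image[OF assms(2,1)] by (simp add: is_interval_connected_1)
  moreover have "h z < 0 \<and> 0 < h w \<or> h w < 0 \<and> 0 < h z"
    using ne assms(3)[OF assms(4)] assms(3)[OF assms(5)] by (auto simp: sgn_if split: if_splits)
  ultimately have "0 \<in> h ` X"
    using assms(4,5) by (meson imageI less_imp_le mem_is_interval_1_I)
  then show False using assms(3) by auto
qed

text \<open>Induction on the stage. Equal earlier signs give equal partial sums, so the tails at z
  and w agree, and the tail at w is too large for z to miss stage n + 1. Inside that stage
  \<open>folded n\<close> has no zero, so connectedness fixes its sign on X.\<close>

lemma connected_level_in_stage:
  assumes X: "connected X" "X \<subseteq> unit_square" "\<And>z. z \<in> X \<Longrightarrow> staircase z = staircase w"
    and w: "w \<in> X" "w \<in> cantor_dust"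
  shows "z \<in> X \<Longrightarrow> \<bar>folded n (z $ i)\<bar> \<le> half_width n \<and>
      (\<forall>m<n. sgn (folded m (z $ i)) = sgn (folded m (w $ i)))"
proof (induction n arbitrary: z i)
  case 0
  then have "z $ i \<in> {0..1}" using X(2) by (auto simp: unit_square_def mem_box_cart)
  then show ?case by (simp add: half_width_0 abs_if)
next
  case (Suc n)
  have wi: "w $ i \<in> fat_cantor" for i using w(2) exhaust_2[of i] by (auto simp: cantor_dust_def)
  \<comment> \<open>Proved for all points of X at once, since the sign argument below needs
    \<open>folded n\<close> to be nonzero on the whole of X.\<close>
  have inside: "\<bar>folded (Suc n) (z $ i)\<bar> \<le> half_width (Suc n)" if z: "z \<in> X" for z i
  proof -
    have "bump m (folded m (z $ i)) = bump m (folded m (w $ i))" if m: "m < n" for m i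
    proof -
      have "\<bar>folded (Suc m) (z $ i)\<bar> \<le> half_width (Suc m)"
        using Suc.IH[OF z, of i] folded_bounded_antimono[of "Suc m" n "z $ i"] m by linarith
      moreover have "\<bar>folded (Suc m) (w $ i)\<bar> \<le> half_width (Suc m)" by (rule fat_cantorD[OF wi])
      moreover have "sgn (folded m (z $ i)) = sgn (folded m (w $ i))" using Suc.IH[OF z, of i] m by blast
      then have "folded m (z $ i) > 0 \<longleftrightarrow> folded m (w $ i) > 0" by (metis sgn_greater)
      ultimately show ?thesis by (simp add: folded_inside del: folded.simps)
    qed
    then have "(\<Sum>m<n. bump m (folded m (z $ i))) = (\<Sum>m<n. bump m (folded m (w $ i)))" for i by simp
    with X(3)[OF z]
    have "2 * ladder_tail n (z $ 1) + ladder_tail n (z $ 2) =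
        2 * ladder_tail n (w $ 1) + ladder_tail n (w $ 2)"
      unfolding staircase_def ladder_split[of _ n] by simp
    also have "\<dots> \<ge> 48 / 4 ^ n"
      using ladder_tail_ge[OF wi[of 1], of n] ladder_tail_ge[OF wi[of 2], of n] by simp
    finally have ge: "48 / 4 ^ n \<le> 2 * ladder_tail n (z $ 1) + ladder_tail n (z $ 2)" .
    define e where "e = 1 / (4::real) ^ n"
    have e: "e > 0" "c / 4 ^ n = c * e" for c by (auto simp: e_def)
    show ?thesis
    proof (rule ccontr)
      assume "\<not> ?thesis"
      then have "ladder_tail n (z $ i) \<le> 13 / 4 ^ n" by (intro ladder_tail_gap) simp
      \<comment> \<open>The tight case is i = 2: 2 * 52/3 + 13 = 143/3 < 48. For i = 1 the sum is at
        most 2 * 13 + 52/3 = 130/3.\<close>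
      then show False
        using ge ladder_tail_le[of n "z $ 1"] ladder_tail_le[of n "z $ 2"] e(1) exhaust_2[of i]
        unfolding e(2) by auto
    qed
  qed
  have "sgn (folded n (z $ i)) = sgn (folded n (w $ i))"
  proof (rule connected_sgn_eq[where h = "\<lambda>z. folded n (z $ i)", OF X(1) _ _ Suc.prems w(1)])
    show "continuous_on X (\<lambda>z. folded n (z $ i))"
      by (rule continuous_on_compose2[OF continuous_on_folded[of UNIV n]]) (auto intro!: continuous_intros)
    show "folded n (z $ i) \<noteq> 0" if "z \<in> X" for z
      using folded_Suc_bounded_imp(2)[OF inside[OF that]] .
  qed
  then show ?case using Suc.IH[OF Suc.prems, of i] inside[OF Suc.prems, of i]
    by (auto simp: less_Suc_eq simp del: folded.simps)
qed

lemma connected_level_singleton: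
  assumes "connected X" "X \<subseteq> unit_square" "\<And>z. z \<in> X \<Longrightarrow> staircase z = staircase w"
    and "w \<in> X" "w \<in> cantor_dust"
  shows "X = {w}"
proof -
  have "z = w" if "z \<in> X" for z
  proof -
    have "z $ i = w $ i" for i
    proof (rule fat_cantor_eqI)
      show "z $ i \<in> fat_cantor" "sgn (folded m (z $ i)) = sgn (folded m (w $ i))" for m
        using connected_level_in_stage[OF assms \<open>z \<in> X\<close>] lessI[of m] unfolding fat_cantor_def by blast+
      show "w $ i \<in> fat_cantor" using assms(5) exhaust_2[of i] by (auto simp: cantor_dust_def)
    qed
    then show ?thesis by (simp add: vec_eq_iff)
  qed
  then show ?thesis using assms(4) by blast
qed

lemma hausdorff1_singleton: "hausdorff1 {x :: 'a :: metric_space} = 0"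
proof -
  have "(INF C\<in>{C :: nat \<Rightarrow> 'a set. {x} \<subseteq> \<Union>(range C) \<and> (\<forall>i. bounded (C i) \<and> diameter (C i) \<le> \<delta>)}.
        (\<Sum>i. ennreal (diameter (C i)))) \<le> 0" if "\<delta> > 0" for \<delta>
    by (rule INF_lower2[where i = "\<lambda>_. {x}"]) (use that in auto)
  then show ?thesis unfolding hausdorff1_def by (auto simp: SUP_eq_iff intro!: antisym SUP_least)
qed

lemma cantor_dust_disjoint_E_star: "cantor_dust \<inter> E_star staircase = {}"
proof (rule ccontr)
  assume "cantor_dust \<inter> E_star staircase \<noteq> {}"
  then obtain w t x where w: "w \<in> cantor_dust" "w \<in> connected_component_set (level_set staircase t) x"
    and H: "0 < hausdorff1 (connected_component_set (level_set staircase t) x)"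
    unfolding E_star_def level_star_def by blast
  let ?X = "connected_component_set (level_set staircase t) x"
  have sub: "?X \<subseteq> level_set staircase t" by (rule connected_component_subset)
  have "?X = {w}"
    by (rule connected_level_singleton) (use w sub in \<open>auto simp: level_set_def\<close>)
  then show False using H by (simp add: hausdorff1_singleton)
qed

subsection \<open>Measure of the Cantor dust\<close>

lemma closed_folded_vimage: "closed {z :: real ^ 2. folded n (z $ i) \<in> {a..b}}"
proof -
  have "continuous_on UNIV (\<lambda>z :: real ^ 2. folded n (z $ i))"
    by (rule continuous_on_compose2[OF continuous_on_folded[of UNIV n]]) (auto intro!: continuous_intros)
  from closed_vimage[OF closed_atLeastAtMost this] show ?thesis by (simp add: vimage_def)
qed

text \<open>Each fold pulls an interval back to two disjoint intervals of the same length, hence the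
  factor 2^n. The set B carries a condition on the other coordinate, so the lemma can be applied
  once per coordinate and replaces a product-measure argument.\<close>

lemma emeasure_folded_vimage:
  fixes B :: "(real ^ 2) set"
  assumes B: "B \<in> sets lborel"
    and base: "\<And>a b. a \<le> b \<Longrightarrow> emeasure lborel ({z. z $ i \<in> {a..b}} \<inter> B) = ennreal ((b - a) * c)"
    and c: "0 \<le> c"
  shows "- half_width n \<le> a \<Longrightarrow> a \<le> b \<Longrightarrow> b \<le> half_width n \<Longrightarrow>
    emeasure lborel ({z. folded n (z $ i) \<in> {a..b}} \<inter> B) = ennreal (2 ^ n * (b - a) * c)"
proof (induction n arbitrary: a b)
  case 0
  have "{z :: real ^ 2. folded 0 (z $ i) \<in> {a..b}} = {z. z $ i \<in> {a + 1/2..b + 1/2}}" by auto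
  then show ?case using base[of "a + 1/2" "b + 1/2"] 0 by simp
next
  case (Suc n)
  let ?h = "half_width n / 2"
  let ?S = "\<lambda>a b. {z :: real ^ 2. folded n (z $ i) \<in> {a..b}} \<inter> B"
  note m = margin_pos[of n] half_width_Suc[of n] half_width_pos[of n]
  \<comment> \<open>This separates the two preimage intervals: one lies right of 0, the other
    left.\<close>
  have pos: "0 < a + ?h" using Suc.prems m by linarith
  have meas: "?S a b \<in> sets lborel" for a b
    using B closed_folded_vimage[of n i a b] by auto
  have "{z :: real ^ 2. folded (Suc n) (z $ i) \<in> {a..b}} \<inter> B = ?S (a + ?h) (b + ?h) \<union> ?S (- b - ?h) (- a - ?h)"
    using pos by (auto simp: abs_if split: if_splits)
  moreover have "emeasure lborel (?S (a + ?h) (b + ?h) \<union> ?S (- b - ?h) (- a - ?h)) =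
      emeasure lborel (?S (a + ?h) (b + ?h)) + emeasure lborel (?S (- b - ?h) (- a - ?h))"
    by (rule plus_emeasure[symmetric]) (use pos meas in auto)
  moreover have "emeasure lborel (?S (a + ?h) (b + ?h)) = ennreal (2 ^ n * ((b + ?h) - (a + ?h)) * c)"
    by (rule Suc.IH) (use Suc.prems m in auto)
  moreover have "emeasure lborel (?S (- b - ?h) (- a - ?h)) = ennreal (2 ^ n * ((- a - ?h) - (- b - ?h)) * c)"
    by (rule Suc.IH) (use Suc.prems m in auto)
  moreover have "0 \<le> 2 ^ n * (b - a) * c" using Suc.prems c by simp
  ultimately show ?case by (simp add: mult_ac flip: ennreal_plus)
qed

lemma emeasure_rectangle_cart:
  fixes a b c d :: real
  assumes "a \<le> b" "c \<le> d"
  shows "emeasure lborel ({z :: real ^ 2. z $ 1 \<in> {a..b}} \<inter> {z. z $ 2 \<in> {c..d}}) = ennreal ((b - a) * (d - c))"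
proof -
  let ?u = "vector [a, c] :: real ^ 2" and ?v = "vector [b, d] :: real ^ 2"
  have eq: "{z :: real ^ 2. z $ 1 \<in> {a..b}} \<inter> {z. z $ 2 \<in> {c..d}} = cbox ?u ?v"
    by (auto simp: mem_box_cart forall_2)
  have "?u \<in> cbox ?u ?v" using assms by (auto simp: mem_box_cart forall_2)
  then have "measure lborel (cbox ?u ?v) = (b - a) * (d - c)"
    by (subst content_cbox_cart) (auto simp: prod_2 UNIV_2)
  then show ?thesis unfolding eq using emeasure_eq_ennreal_measure[of lborel "cbox ?u ?v"]
      emeasure_lborel_cbox_finite[of ?u ?v] by simp
qed

definition dust_stage :: "nat \<Rightarrow> (real ^ 2) set" where
  "dust_stage n = {z. \<bar>folded n (z $ 1)\<bar> \<le> half_width n \<and> \<bar>folded n (z $ 2)\<bar> \<le> half_width n}"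

lemma dust_stage_eq:
  "dust_stage n = {z. folded n (z $ 2) \<in> {- half_width n..half_width n}} \<inter> {z. folded n (z $ 1) \<in> {- half_width n..half_width n}}"
  by (auto simp: dust_stage_def)

lemma closed_dust_stage: "closed (dust_stage n)"
  unfolding dust_stage_eq by (intro closed_Int closed_folded_vimage)

text \<open>First coordinate 1 is folded, with B a strip in coordinate 2; the result is the base
  case for folding coordinate 2.\<close>

lemma emeasure_dust_stage: "emeasure lborel (dust_stage n) = ennreal ((2 ^ n * (2 * half_width n))\<^sup>2)"
proof -
  have 1: "emeasure lborel ({z :: real ^ 2. folded n (z $ 1) \<in> {- half_width n..half_width n}} \<inter> {z. z $ 2 \<in> {a..b}})
      = ennreal (2 ^ n * (half_width n - - half_width n) * (b - a))" if "a \<le> b" for a b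
  proof (rule emeasure_folded_vimage)
    show "{z :: real ^ 2. z $ 2 \<in> {a..b}} \<in> sets lborel"
      using borel_closed[OF closed_vimage_vec_nth[OF closed_atLeastAtMost[of a b]]]
      by (simp add: vimage_def)
  qed (use that half_width_pos[of n] emeasure_rectangle_cart in auto)
  have "emeasure lborel (dust_stage n) = ennreal (2 ^ n * (half_width n - - half_width n) * (2 ^ n * (half_width n - - half_width n)))"
    unfolding dust_stage_eq
  proof (rule emeasure_folded_vimage)
    show "emeasure lborel ({z :: real ^ 2. z $ 2 \<in> {a..b}} \<inter> {z. folded n (z $ 1) \<in> {- half_width n..half_width n}})
        = ennreal ((b - a) * (2 ^ n * (half_width n - - half_width n)))" if "a \<le> b" for a b
      using 1[OF that] by (simp add: Int_commute mult.commute)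
  qed (use half_width_pos[of n] closed_folded_vimage in auto)
  then show ?thesis by (simp add: power2_eq_square)
qed

lemma cantor_dust_eq: "cantor_dust = (\<Inter>n. dust_stage n)"
  by (auto simp: cantor_dust_def dust_stage_def fat_cantor_def)

lemma closed_cantor_dust: "closed cantor_dust"
  unfolding cantor_dust_eq using closed_dust_stage by blast

lemma emeasure_cantor_dust: "emeasure lborel cantor_dust \<ge> ennreal (1/4)"
proof -
  have "(INF n. emeasure lborel (dust_stage n)) = emeasure lborel (\<Inter>n. dust_stage n)"
  proof (rule INF_emeasure_decseq)
    show "decseq dust_stage"
      using folded_bounded_antimono by (auto simp: decseq_def dust_stage_def)
  qed (auto simp: emeasure_dust_stage closed_dust_stage)
  moreover have "ennreal (1/4) \<le> emeasure lborel (dust_stage n)" for n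
  proof -
    have "1/2 \<le> 2 ^ n * (2 * half_width n)" using half_width_ge[of n] by (simp add: field_simps)
    then have "(1/2)\<^sup>2 \<le> (2 ^ n * (2 * half_width n))\<^sup>2" by (intro power_mono) auto
    then show ?thesis unfolding emeasure_dust_stage by (simp add: power2_eq_square)
  qed
  ultimately show ?thesis unfolding cantor_dust_eq by (metis INF_greatest)
qed

lemma cantor_dust_not_negligible: "\<not> negligible cantor_dust"
proof
  assume "negligible cantor_dust"
  then have "emeasure lebesgue cantor_dust = 0" by (simp add: negligible_iff_emeasure0 closed_cantor_dust)
  then have "emeasure lborel cantor_dust = 0"
    using closed_cantor_dust by (simp add: borel_closed)
  with emeasure_cantor_dust show False by simp
qed

section \<open>Base-4 codes of the dust cells\<close>

fun dust_code :: "nat \<Rightarrow> real ^ 2 \<Rightarrow> nat" where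
  "dust_code 0 z = 0"
| "dust_code (Suc n) z = 4 * dust_code n z + (2 * of_bool (folded n (z $ 1) > 0) + of_bool (folded n (z $ 2) > 0))"

lemma dust_code_inj:
  assumes "dust_code n z = dust_code n w" "m < n"
  shows "folded m (z $ i) > 0 \<longleftrightarrow> folded m (w $ i) > 0"
  using assms
proof (induction n)
  case (Suc n)
  have "(4 * dust_code n z + (2 * of_bool (folded n (z $ 1) > 0) + of_bool (folded n (z $ 2) > 0))) div 4
      = dust_code n z" for z
    by simp
  with Suc.prems(1) have 1: "dust_code n z = dust_code n w" by (metis dust_code.simps(2))
  with Suc.prems(1) have "2 * of_bool (folded n (z $ 1) > 0) + of_bool (folded n (z $ 2) > 0) =
      (2 * of_bool (folded n (w $ 1) > 0) + of_bool (folded n (w $ 2) > 0) :: nat)" by simp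
  then have "(folded n (z $ 1) > 0 \<longleftrightarrow> folded n (w $ 1) > 0) \<and> (folded n (z $ 2) > 0 \<longleftrightarrow> folded n (w $ 2) > 0)"
    by (auto simp: of_bool_def split: if_splits)
  then have "folded n (z $ i) > 0 \<longleftrightarrow> folded n (w $ i) > 0" using exhaust_2[of i] by auto
  then show ?case using Suc.IH[OF 1] Suc.prems(2) by (auto simp: less_Suc_eq)
qed simp

text \<open>The constant part 36 / 4^m of the first n stages sums to 48 - 48 / 4^n, the digits
  contribute 4 * code / 4^n, and the tail lies between 48 / 4^n and 52 / 4^n. So cells with
  consecutive codes have values in adjacent intervals of length 4 / 4^n.\<close>

lemma staircase_dust_code:
  assumes "z \<in> cantor_dust"
  shows "staircase z \<ge> 48 + 4 * (real (dust_code n z) / 4 ^ n)"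
    "staircase z \<le> 48 + 4 * (real (dust_code n z) / 4 ^ n) + 4 / 4 ^ n"
proof -
  have z: "z $ 1 \<in> fat_cantor" "z $ 2 \<in> fat_cantor" using assms by (auto simp: cantor_dust_def)
  have s: "2 * (\<Sum>m<n. bump m (folded m (z $ 1))) + (\<Sum>m<n. bump m (folded m (z $ 2))) =
      48 - 48 / 4 ^ n + 4 * (real (dust_code n z) / 4 ^ n)"
  proof (induction n)
    case (Suc n)
    have b: "bump n (folded n (z $ 1)) = (12 + of_bool (folded n (z $ 1) > 0)) / 4 ^ n"
      "bump n (folded n (z $ 2)) = (12 + of_bool (folded n (z $ 2) > 0)) / 4 ^ n"
      by (rule folded_inside(1)[OF fat_cantorD], rule z)+
    have lin: "2 * (s + (12 + d) / p) + (t + (12 + e) / p) = 48 - 48 / (4 * p) + 4 * ((4 * k + (2 * d + e)) / (4 * p))"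
      if "2 * s + t = 48 - 48 / p + 4 * (k / p)" for s t d e k p :: real
      using that by (simp add: add_divide_distrib)
    show ?case using lin[OF Suc.IH] by (simp add: b)
  qed simp
  have "2 * ladder_tail n (z $ 1) + ladder_tail n (z $ 2) \<ge> 48 / 4 ^ n"
    "2 * ladder_tail n (z $ 1) + ladder_tail n (z $ 2) \<le> 52 / 4 ^ n"
    using ladder_tail_ge[OF z(1), of n] ladder_tail_ge[OF z(2), of n]
      ladder_tail_le[of n "z $ 1"] ladder_tail_le[of n "z $ 2"] by simp_all
  moreover have "staircase z = 2 * ladder_tail n (z $ 1) + ladder_tail n (z $ 2) +
      (48 - 48 / 4 ^ n + 4 * (real (dust_code n z) / 4 ^ n))"
    unfolding staircase_def ladder_split[of _ n] s[symmetric] by simp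
  ultimately show "staircase z \<ge> 48 + 4 * (real (dust_code n z) / 4 ^ n)"
    "staircase z \<le> 48 + 4 * (real (dust_code n z) / 4 ^ n) + 4 / 4 ^ n"
    by (simp_all add: field_simps)
qed

lemma dust_cell_cover:
  obtains T where "{z \<in> cantor_dust. dust_code n z = k} \<subseteq> T" "T \<in> lmeasurable"
    "measure lebesgue T \<le> 4 / 4 ^ n"
proof (cases "{z \<in> cantor_dust. dust_code n z = k} = {}")
  case True
  then show ?thesis using that[of "{}"] by simp
next
  case False
  then obtain w where w: "w \<in> cantor_dust" "dust_code n w = k" by blast
  \<comment> \<open>A box around an arbitrary point w of the cell needs twice the cell's side bound
    2^-n, whence the area 4 / 4^n.\<close>
  let ?u = "\<chi> i. w $ i - 1 / 2 ^ n" and ?v = "\<chi> i. w $ i + 1 / 2 ^ n"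
  have "{z \<in> cantor_dust. dust_code n z = k} \<subseteq> cbox ?u ?v"
  proof safe
    fix z assume z: "z \<in> cantor_dust" "k = dust_code n z"
    have "\<bar>z $ i - w $ i\<bar> \<le> 1 / 2 ^ n" for i
    proof -
      have zi: "z $ i \<in> fat_cantor" "w $ i \<in> fat_cantor"
        using z(1) w(1) exhaust_2[of i] by (auto simp: cantor_dust_def)
      have "sgn (folded m (z $ i)) = sgn (folded m (w $ i))" if "m < n" for m
      proof -
        have "folded m (z $ i) \<noteq> 0" "folded m (w $ i) \<noteq> 0"
          using folded_Suc_bounded_imp(2) fat_cantorD zi by blast+
        then show ?thesis using dust_code_inj[of n z w m i] z(2) w(2) that by (auto simp: sgn_if)
      qed
      then have "\<bar>z $ i - w $ i\<bar> = \<bar>folded n (z $ i) - folded n (w $ i)\<bar>" by (metis folded_isometry)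
      also have "\<dots> \<le> half_width n + half_width n"
        using fat_cantorD[OF zi(1), of n] fat_cantorD[OF zi(2), of n] by linarith
      also have "\<dots> \<le> 1 / 2 ^ n" using half_width_le[of n] by simp
      finally show ?thesis .
    qed
    then show "z \<in> cbox ?u ?v" by (auto simp: mem_box_cart abs_le_iff algebra_simps)
  qed
  moreover have "measure lborel (cbox ?u ?v) = 4 / 4 ^ n"
  proof -
    have "w \<in> cbox ?u ?v" by (auto simp: mem_box_cart)
    then have "measure lborel (cbox ?u ?v) = (2 / 2 ^ n) * (2 / 2 ^ n)"
      by (subst content_cbox_cart) (auto simp: prod_2 UNIV_2)
    also have "\<dots> = 4 / 4 ^ n" by (simp flip: power_mult_distrib)
    finally show ?thesis .
  qed
  ultimately show ?thesis using that[of "cbox ?u ?v"] by simp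
qed

subsection \<open>Absolute continuity on the dust and the theorem\<close>

lemma continuous_staircase: "continuous_on S staircase"
  unfolding staircase_def[abs_def]
  by (intro continuous_intros continuous_on_compose2[OF continuous_ladder[of UNIV]]) auto

lemma closed_dust_vimage: "closed {z \<in> cantor_dust. staircase z \<in> {u..v}}"
  using closed_Int[OF closed_cantor_dust
      closed_vimage[OF closed_atLeastAtMost continuous_staircase[of UNIV]]]
  by (simp add: Collect_conj_eq vimage_def)

text \<open>At the scale 4^-n of v - u, the preimage meets cells of at most three consecutive codes,
  each covered by area 4 / 4^n.\<close>

lemma dust_vimage_measure:
  assumes "0 < v - u" "v - u \<le> 4"
  shows "{z \<in> cantor_dust. staircase z \<in> {u..v}} \<in> lmeasurable"
    "measure lebesgue {z \<in> cantor_dust. staircase z \<in> {u..v}} \<le> 12 * (v - u)"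
proof -
  let ?A = "{z \<in> cantor_dust. staircase z \<in> {u..v}}"
  \<comment> \<open>The least n with 4^-n < v - u; if it is 0, the upper bound is the hypothesis v -
    u \<le> 4.\<close>
  obtain n where n: "1 / 4 ^ n < v - u" "v - u \<le> 4 / 4 ^ n"
  proof -
    obtain j where "(1/4::real) ^ j < v - u" using real_arch_pow_inv[OF assms(1), of "1/4"] by auto
    then obtain m where m: "1 / 4 ^ m < v - u" "\<And>k. k < m \<Longrightarrow> \<not> 1 / 4 ^ k < v - u"
      using exists_least_iff[of "\<lambda>j. 1 / 4 ^ j < v - u"] by (auto simp: power_divide)
    have "v - u \<le> 4 / 4 ^ m"
    proof (cases m)
      case 0
      then show ?thesis using assms by simp
    next
      case (Suc k)
      then show ?thesis using m(2)[of k] by simp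
    qed
    then show ?thesis using that m by blast
  qed
  define cell where "cell k = {z \<in> cantor_dust. dust_code n z = k}" for k
  have "\<forall>k. \<exists>T. cell k \<subseteq> T \<and> T \<in> lmeasurable \<and> measure lebesgue T \<le> 4 / 4 ^ n"
  proof
    fix k
    show "\<exists>T. cell k \<subseteq> T \<and> T \<in> lmeasurable \<and> measure lebesgue T \<le> 4 / 4 ^ n"
      unfolding cell_def by (rule dust_cell_cover[of n k]) blast
  qed
  then obtain T where T: "\<And>k. cell k \<subseteq> T k" "\<And>k. T k \<in> lmeasurable" "\<And>k. measure lebesgue (T k) \<le> 4 / 4 ^ n"
    by metis
  obtain k where k: "?A \<subseteq> T k \<union> T (Suc k) \<union> T (Suc (Suc k))"
  proof (cases "?A = {}")
    case False
    obtain w where w: "w \<in> ?A" "\<And>z. z \<in> ?A \<Longrightarrow> dust_code n w \<le> dust_code n z"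
      using ex_has_least_nat[of "\<lambda>z. z \<in> ?A" _ "dust_code n"] False by blast
    have "z \<in> T (dust_code n w) \<union> T (Suc (dust_code n w)) \<union> T (Suc (Suc (dust_code n w)))" if z: "z \<in> ?A" for z
    proof -
      \<comment> \<open>w has the least code. One code step comes from v - u \<le> 4 / 4^n and one
        from the length of the value interval of w's cell.\<close>
      have "real (dust_code n z) / 4 ^ n \<le> real (dust_code n w) / 4 ^ n + 2 / 4 ^ n"
        using staircase_dust_code(1)[of z n] staircase_dust_code(2)[of w n] z w(1) n(2) by simp
      then have "real (dust_code n z) / 4 ^ n \<le> real (dust_code n w + 2) / 4 ^ n"
        by (simp add: add_divide_distrib)
      then have "dust_code n z \<le> dust_code n w + 2" by (simp add: divide_le_cancel)
      with w(2)[OF z] have "dust_code n z \<in> {dust_code n w, Suc (dust_code n w), Suc (Suc (dust_code n w))}"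
        by auto
      moreover have "z \<in> T (dust_code n z)" using T(1)[of "dust_code n z"] z by (auto simp: cell_def)
      ultimately show ?thesis by auto
    qed
    then show ?thesis using that by blast
  qed (use that in blast)
  have lm: "T k \<union> T (Suc k) \<union> T (Suc (Suc k)) \<in> lmeasurable" using T(2) by blast
  show A: "?A \<in> lmeasurable"
    by (rule fmeasurableI2[OF lm k]) (use borel_closed[OF closed_dust_vimage[of u v]] in simp)
  have "measure lebesgue ?A \<le> measure lebesgue (T k \<union> T (Suc k) \<union> T (Suc (Suc k)))"
    by (rule measure_mono_fmeasurable[OF k _ lm]) (use A in auto)
  also have "\<dots> \<le> measure lebesgue (T k \<union> T (Suc k)) + measure lebesgue (T (Suc (Suc k)))"
    by (rule measure_Un_le) (use T(2) in auto)
  also have "\<dots> \<le> measure lebesgue (T k) + measure lebesgue (T (Suc k)) + measure lebesgue (T (Suc (Suc k)))"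
    by (intro add_right_mono measure_Un_le) (use T(2) in auto)
  also have "\<dots> \<le> 12 / 4 ^ n" using T(3)[of k] T(3)[of "Suc k"] T(3)[of "Suc (Suc k)"] by simp
  also have "\<dots> \<le> 12 * (v - u)" using n(1) by simp
  finally show "measure lebesgue ?A \<le> 12 * (v - u)" .
qed

text \<open>Absolute continuity: N is covered by nonoverlapping intervals of total length at most e
  / 12, and preimages of intervals in the dust cost at most a factor 12.\<close>

lemma negligible_dust_vimage:
  assumes "negligible N"
  shows "negligible {z \<in> cantor_dust. staircase z \<in> N}"
  unfolding negligible_outer_le
proof (intro allI impI)
  fix e :: real assume e: "e > 0"
  \<comment> \<open>All dust values lie in [48, 52], by the case n = 0 of
    \<open>staircase_dust_code\<close>.\<close>
  let ?N = "N \<inter> {48..52}"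
  have N: "negligible ?N" using assms by (meson negligible_Int)
  then have lm: "?N \<in> lmeasurable" "measure lebesgue ?N = 0"
    by (auto simp: negligible_imp_measurable negligible_imp_measure0)
  have sub: "?N \<subseteq> cbox 48 52" by auto
  obtain D where D: "countable D"
      "\<And>K. K \<in> D \<Longrightarrow> K \<subseteq> cbox 48 52 \<and> K \<noteq> {} \<and> (\<exists>c d. K = cbox c d)"
      "pairwise (\<lambda>A B. interior A \<inter> interior B = {}) D"
      "\<And>u v. cbox u v \<in> D \<Longrightarrow> \<exists>n. \<forall>i \<in> Basis. v \<bullet> i - u \<bullet> i = (52 \<bullet> i - 48 \<bullet> i) / 2 ^ n"
      "?N \<subseteq> \<Union>D" "\<Union>D \<in> lmeasurable" "measure lebesgue (\<Union>D) \<le> measure lebesgue ?N + e / 12"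
    using measurable_outer_intervals_bounded[OF lm(1) sub, of "e / 12"] e by (metis divide_pos_pos zero_less_numeral)
  let ?T = "\<lambda>K. {z \<in> cantor_dust. staircase z \<in> K}"
  have K: "?T K \<in> lmeasurable \<and> measure lebesgue (?T K) \<le> 12 * measure lebesgue K" if K: "K \<in> D" for K
  proof -
    obtain u v where uv: "K = cbox u v" using D(2)[OF K] by blast
    \<comment> \<open>The dyadic side lengths give 0 < v - u \<le> 4, as
      \<open>dust_vimage_measure\<close> requires.\<close>
    then obtain n where n: "v - u = 4 / 2 ^ n" using D(4)[of u v] K by auto
    have "0 < v - u" "v - u \<le> 4" unfolding n by (auto simp: divide_le_eq)
    from dust_vimage_measure[OF this] this(1) uv show ?thesis by simp
  qed
  have neg: "pairwise (\<lambda>A B. negligible (A \<inter> B)) D"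
  proof (rule pairwiseI)
    fix A B assume AB: "A \<in> D" "B \<in> D" "A \<noteq> B"
    then obtain a b c d where ab: "A = {a..b}" "B = {c..d}" using D(2) by (metis cbox_interval)
    have "interior A \<inter> interior B = {}" using D(3) AB by (simp add: pairwise_def)
    then have "A \<inter> B \<subseteq> {a, b, c, d}" unfolding ab by (auto simp: interior_atLeastAtMost_real disjoint_iff)
    then show "negligible (A \<inter> B)" by (meson negligible_finite negligible_subset finite.intros)
  qed
  \<comment> \<open>A bound uniform over finite subfamilies passes to the countable union.\<close>
  have bound: "measure lebesgue (\<Union>K\<in>F. ?T K) \<le> e" if F: "F \<subseteq> D" "finite F" for F
  proof -
    have FK: "K \<in> lmeasurable" if "K \<in> F" for K using D(2) F that by (metis lmeasurable_cbox subset_eq)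
    have "measure lebesgue (\<Union>K\<in>F. ?T K) \<le> (\<Sum>K\<in>F. measure lebesgue (?T K))"
      by (rule measure_UNION_le) (use F K in blast)+
    also have "\<dots> \<le> (\<Sum>K\<in>F. 12 * measure lebesgue K)"
      by (rule sum_mono) (use F K in blast)
    also have "\<dots> = 12 * measure lebesgue (\<Union>F)"
      using measure_negligible_finite_Union[OF F(2) FK pairwise_subset[OF neg F(1)]]
      by (simp add: sum_distrib_left)
    also have "measure lebesgue (\<Union>F) \<le> measure lebesgue (\<Union>D)"
      by (rule measure_mono_fmeasurable) (use F FK D(6) in \<open>auto intro!: fmeasurableD fmeasurable.finite_Union\<close>)
    finally show ?thesis using D(7) lm(2) by simp
  qed
  show "\<exists>T. {z \<in> cantor_dust. staircase z \<in> N} \<subseteq> T \<and> T \<in> lmeasurable \<and> measure lebesgue T \<le> e"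
  proof (intro exI conjI)
    show "{z \<in> cantor_dust. staircase z \<in> N} \<subseteq> (\<Union>K\<in>D. ?T K)"
    proof safe
      fix z assume z: "z \<in> cantor_dust" "staircase z \<in> N"
      then have "staircase z \<in> ?N" using staircase_dust_code[OF z(1), of 0] by auto
      then show "z \<in> (\<Union>K\<in>D. ?T K)" using D(5) z(1) by blast
    qed
    show "(\<Union>K\<in>D. ?T K) \<in> lmeasurable"
      by (rule fmeasurable_UN_bound[OF D(1) _ bound]) (use K in blast)+
    show "measure lebesgue (\<Union>K\<in>D. ?T K) \<le> e"
      by (rule measure_UN_bound[OF D(1) _ bound]) (use K in blast)+
  qed
qed

section \<open>Regularity and critical points of the staircase\<close>

definition staircase_grad :: "real ^ 2 \<Rightarrow> real ^ 2" where
  "staircase_grad z = vector [2 * ladder_deriv (z $ 1), ladder_deriv (z $ 2)]"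

lemma staircase_has_derivative: "(staircase has_derivative (\<lambda>h. staircase_grad z \<bullet> h)) (at z within S)"
proof -
  have c: "((\<lambda>z. ladder (z $ i)) has_derivative (\<lambda>h. h $ i * ladder_deriv (z $ i))) (at z within S)" for i :: 2
    by (rule DERIV_compose_FDERIV[OF DERIV_ladder])
       (rule bounded_linear_imp_has_derivative[OF bounded_linear_vec_nth])
  have "(staircase has_derivative (\<lambda>h. 2 * (h $ 1 * ladder_deriv (z $ 1)) + h $ 2 * ladder_deriv (z $ 2))) (at z within S)"
    unfolding staircase_def[abs_def]
    by (intro has_derivative_add has_derivative_mult_right c)
  then show ?thesis by (simp add: staircase_grad_def inner_vec_def sum_2 mult_ac)
qed

lemma C1_alpha_staircase:
  assumes "0 < \<alpha>" "\<alpha> < 1"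
  shows "C1_alpha \<alpha> staircase"
proof -
  obtain C where C: "0 \<le> C" "\<And>x y. \<bar>ladder_deriv x - ladder_deriv y\<bar> \<le> C * \<bar>x - y\<bar> powr \<alpha>"
    using ladder_deriv_holder[OF assms] by blast
  have "norm (staircase_grad x - staircase_grad y) \<le> 3 * C * dist x y powr \<alpha>" for x y
  proof -
    have i: "\<bar>ladder_deriv (x $ i) - ladder_deriv (y $ i)\<bar> \<le> C * dist x y powr \<alpha>" for i
    proof -
      have "\<bar>x $ i - y $ i\<bar> \<le> dist x y" using component_le_norm_cart[of "x - y" i] by (simp add: dist_norm)
      then have "C * \<bar>x $ i - y $ i\<bar> powr \<alpha> \<le> C * dist x y powr \<alpha>"
        using C(1) assms by (intro mult_left_mono powr_mono2) auto
      then show ?thesis using C(2)[of "x $ i" "y $ i"] by linarith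
    qed
    have "norm (staircase_grad x - staircase_grad y) \<le>
        2 * \<bar>ladder_deriv (x $ 1) - ladder_deriv (y $ 1)\<bar> + \<bar>ladder_deriv (x $ 2) - ladder_deriv (y $ 2)\<bar>"
    proof -
      have "(staircase_grad x - staircase_grad y) $ 1 = 2 * (ladder_deriv (x $ 1) - ladder_deriv (y $ 1))"
        "(staircase_grad x - staircase_grad y) $ 2 = ladder_deriv (x $ 2) - ladder_deriv (y $ 2)"
        by (simp_all add: staircase_grad_def)
      then show ?thesis
        using norm_le_l1_cart[of "staircase_grad x - staircase_grad y"] by (simp only: sum_2 abs_mult)
    qed
    then show ?thesis using i[of 1] i[of 2] by simp
  qed
  then show ?thesis unfolding C1_alpha_def using staircase_has_derivative by blast
qed

lemma critical_set_staircase: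
  "critical_set staircase = {z \<in> unit_square. ladder_deriv (z $ 1) = 0 \<and> ladder_deriv (z $ 2) = 0}"
proof -
  have "(staircase has_derivative (\<lambda>h. 0)) (at z within unit_square) \<longleftrightarrow>
      ladder_deriv (z $ 1) = 0 \<and> ladder_deriv (z $ 2) = 0" if z: "z \<in> unit_square" for z
  proof
    assume d: "(staircase has_derivative (\<lambda>h. 0)) (at z within unit_square)"
    \<comment> \<open>The square is a nondegenerate box, so the derivative within it is unique even
      at boundary points. Evaluating it at the gradient itself shows that the gradient is 0.\<close>
    have "\<And>i. i \<in> Basis \<Longrightarrow> (0 :: real ^ 2) \<bullet> i < 1 \<bullet> i" by (auto simp: Basis_vec_def inner_axis)
    then have "(\<lambda>h. staircase_grad z \<bullet> h) = (\<lambda>h. 0)"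
      by (rule frechet_derivative_unique_within_closed_interval[OF _ z[unfolded unit_square_def]
            staircase_has_derivative d[unfolded unit_square_def]])
    then have "staircase_grad z \<bullet> staircase_grad z = 0" by metis
    then have "staircase_grad z = 0" by simp
    then show "ladder_deriv (z $ 1) = 0 \<and> ladder_deriv (z $ 2) = 0"
      by (simp add: staircase_grad_def vec_eq_iff forall_2)
  next
    assume "ladder_deriv (z $ 1) = 0 \<and> ladder_deriv (z $ 2) = 0"
    then have "staircase_grad z = 0" by (simp add: staircase_grad_def vec_eq_iff forall_2)
    then show "(staircase has_derivative (\<lambda>h. 0)) (at z within unit_square)"
      using staircase_has_derivative[of z unit_square] by simp
  qed
  moreover have "staircase differentiable (at z within unit_square)" for z
    using staircase_has_derivative by (rule differentiableI)
  ultimately show ?thesis unfolding critical_set_def by blast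
qed

lemma closed_critical_set: "closed (critical_set staircase)"
proof -
  have "closed {z :: real ^ 2. ladder_deriv (z $ i) = 0}" for i
    by (intro closed_Collect_eq continuous_intros continuous_on_compose2[OF continuous_ladder_deriv]) auto
  then show ?thesis unfolding critical_set_staircase
    by (intro closed_Collect_conj) (auto simp: unit_square_def)
qed

lemma cantor_dust_subset_critical_set: "cantor_dust \<subseteq> critical_set staircase"
proof
  fix z assume z: "z \<in> cantor_dust"
  have "0 \<le> z $ i \<and> z $ i \<le> 1" for i
  proof -
    have "z $ i \<in> fat_cantor" using z exhaust_2[of i] by (auto simp: cantor_dust_def)
    from fat_cantorD[OF this, of 0] show ?thesis by (simp add: half_width_0 abs_if split: if_splits)
  qed
  then show "z \<in> critical_set staircase"
    using z by (auto simp: critical_set_staircase unit_square_def mem_box_cart cantor_dust_def ladder_deriv_fat_cantor)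
qed

lemma negligible_vimage_nth_countable:
  assumes "countable A"
  shows "negligible {z :: real ^ 2. z $ i \<in> A}"
proof -
  have "negligible (\<Union>a\<in>A. {z :: real ^ 2. z $ i = a})"
  proof (rule negligible_countable_Union)
    show "negligible S" if "S \<in> (\<lambda>a. {z :: real ^ 2. z $ i = a}) ` A" for S
      using that negligible_hyperplane[of "axis i 1 :: real ^ 2"]
      by (auto simp: inner_axis inner_commute axis_eq_0_iff)
  qed (use assms in simp)
  moreover have "(\<Union>a\<in>A. {z :: real ^ 2. z $ i = a}) = {z. z $ i \<in> A}" by auto
  ultimately show ?thesis by simp
qed

text \<open>The dust misses \<open>E_star\<close>, and a critical point off the dust has a
  coordinate in a countable set, so it lies on one of countably many lines.\<close>

lemma negligible_critical_set_E_star: "negligible (critical_set staircase \<inter> E_star staircase)"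
proof -
  let ?Z = "{x \<in> {0..1}. ladder_deriv x = 0 \<and> x \<notin> fat_cantor}"
  have "critical_set staircase - cantor_dust \<subseteq> {z. z $ 1 \<in> ?Z} \<union> {z. z $ 2 \<in> ?Z}"
    by (auto simp: critical_set_staircase unit_square_def mem_box_cart cantor_dust_def)
  moreover have "critical_set staircase \<inter> E_star staircase \<subseteq> critical_set staircase - cantor_dust"
    using cantor_dust_disjoint_E_star by blast
  moreover have "negligible ({z :: real ^ 2. z $ 1 \<in> ?Z} \<union> {z. z $ 2 \<in> ?Z})"
    by (intro negligible_Un negligible_vimage_nth_countable countable_ladder_deriv_zero)
  ultimately show ?thesis by (meson negligible_subset)
qed

section \<open>Pushforward measures and the final argument\<close>

lemma emeasure_pushforward:
  assumes f: "continuous_on unit_square f" and A: "A \<in> sets lebesgue" "A \<subseteq> unit_square" and N: "N \<in> sets borel"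
  shows "emeasure (pushforward f A) N = emeasure lebesgue {z \<in> A. f z \<in> N}"
proof -
  let ?M = "lebesgue_on unit_square"
  have sq: "unit_square \<in> sets lebesgue" by (simp add: unit_square_def)
  have fm: "f \<in> borel_measurable ?M"
    by (rule continuous_imp_measurable_on_sets_lebesgue[OF f sq])
  then have fm': "f \<in> measurable (density ?M (indicator A)) borel" by simp
  have pre: "f -` N \<inter> unit_square \<in> sets ?M" using measurable_sets[OF fm N] by simp
  have AM: "A \<in> sets ?M" using A by (simp add: sets_restrict_space_iff[of unit_square lebesgue] sq)
  have "emeasure (pushforward f A) N = emeasure (density ?M (indicator A)) (f -` N \<inter> unit_square)"
    unfolding pushforward_def by (subst emeasure_distr[OF fm' N]) simp
  also have "\<dots> = (\<integral>\<^sup>+z. indicator A z * indicator (f -` N \<inter> unit_square) z \<partial>?M)"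
    by (rule emeasure_density[OF borel_measurable_indicator[OF AM] pre])
  also have "\<dots> = (\<integral>\<^sup>+z. indicator (A \<inter> (f -` N \<inter> unit_square)) z \<partial>?M)"
    by (simp add: indicator_inter_arith)
  also have "\<dots> = emeasure ?M (A \<inter> (f -` N \<inter> unit_square))"
    by (rule nn_integral_indicator) (use AM pre in auto)
  also have "\<dots> = emeasure lebesgue (A \<inter> (f -` N \<inter> unit_square))"
    by (rule emeasure_restrict_space) (use sq in auto)
  also have "A \<inter> (f -` N \<inter> unit_square) = {z \<in> A. f z \<in> N}" using A(2) by auto
  finally show ?thesis .
qed

theorem theorem2:
  shows "\<exists>f :: real^2 \<Rightarrow> real.
           (\<forall>\<alpha>\<in>{0<..<1}. C1_alpha \<alpha> f) \<and>
           mutually_singular (pushforward f (critical_set f \<inter> E_star f)) lborel \<and>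
           \<not> mutually_singular (pushforward f (critical_set f)) lborel"
proof (intro exI conjI)
  let ?S = "critical_set staircase"
  note push = emeasure_pushforward[OF continuous_staircase]
  have sub: "?S \<subseteq> unit_square" by (auto simp: critical_set_def)
  show "\<forall>\<alpha>\<in>{0<..<1}. C1_alpha \<alpha> staircase" using C1_alpha_staircase by simp
  show "mutually_singular (pushforward staircase (?S \<inter> E_star staircase)) lborel"
    unfolding mutually_singular_def
  \<comment> \<open>The restricted pushforward is the zero measure, so the whole line serves as its
    null set.\<close>
  proof (intro exI[of _ UNIV] conjI)
    have "emeasure (pushforward staircase (?S \<inter> E_star staircase)) UNIV = emeasure lebesgue (?S \<inter> E_star staircase)"
      using push[OF negligible_imp_sets[OF negligible_critical_set_E_star] le_infI1[OF sub], of UNIV]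
      by (simp add: Int_def)
    moreover have "emeasure lebesgue (?S \<inter> E_star staircase) = 0"
      using negligible_critical_set_E_star negligible_iff_emeasure0 negligible_imp_sets by blast
    ultimately show "emeasure (pushforward staircase (?S \<inter> E_star staircase)) UNIV = 0" by metis
  qed (auto simp: pushforward_def)
  show "\<not> mutually_singular (pushforward staircase ?S) lborel"
  proof
    \<comment> \<open>A separating N would split the dust into two negligible parts: points with
      value in N are null for the pushforward, and points with value outside N are null by absolute
      continuity.\<close>
    assume "mutually_singular (pushforward staircase ?S) lborel"
    then obtain N where N: "N \<in> sets borel" "emeasure (pushforward staircase ?S) N = 0"
      "emeasure lborel (UNIV - N) = 0"
      unfolding mutually_singular_def by auto
    have S: "?S \<in> sets lebesgue" using closed_critical_set by (simp add: borel_closed)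
    have "emeasure lebesgue {z \<in> ?S. staircase z \<in> N} = 0" using push[OF S sub N(1)] N(2) by simp
    moreover have "{z \<in> ?S. staircase z \<in> N} \<in> sets lebesgue"
    proof -
      have "staircase -` N \<in> sets borel"
        using measurable_sets[OF borel_measurable_continuous_onI[OF continuous_staircase] N(1)] by simp
      then have "?S \<inter> staircase -` N \<in> sets lebesgue" using S by (intro sets.Int) auto
      then show ?thesis by (simp add: vimage_def Collect_conj_eq)
    qed
    ultimately have "negligible {z \<in> ?S. staircase z \<in> N}" by (simp add: negligible_iff_emeasure0)
    moreover have "negligible (UNIV - N)"
      using N by (subst negligible_iff_emeasure0) auto
    then have "negligible {z \<in> cantor_dust. staircase z \<in> UNIV - N}" by (rule negligible_dust_vimage)
    ultimately have "negligible ({z \<in> ?S. staircase z \<in> N} \<union> {z \<in> cantor_dust. staircase z \<in> UNIV - N})"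
      by (rule negligible_Un)
    then have "negligible cantor_dust"
      by (rule negligible_subset) (use cantor_dust_subset_critical_set in auto)
    then show False using cantor_dust_not_negligible by simp
  qed
qed

end
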